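(* Let $f:X\to\mathbb{R}$ be Lipschitz with $f>0$. Then the measures $\mu_{c,s}$ satisfy a Large Deviation Principle with deviation function $\widetilde I$: for fixed $L>0$ and every cylinder $k\subset X$, $$\lim\frac{1}{c}\log\mu_{c,s}(k)=-\inf_{x\in k}\widetilde I(x),$$ where the limit is taken as $c\to\infty$, $s\to1$ (with $c>0$, $s\in(0,1)$) with $c(1-s)\to L$, and $\widetilde I:X\to\mathbb{R}\cup\{\infty\}$ is lower semi-continuous and non-negative. The same is true if, instead of $c(1-s)\to L$, one assumes $\liminf_{c\to\infty,\,s\to1}c(1-s)=L>0$. (Limits are understood along arbitrary sequences $(c_j,s_j)$ with $c_j\to\infty$, $s_j\to 1$ satisfying the stated constraint.)
   Context: $X=\{1,\dots,d\}^{\mathbb{N}}$ is the full Bernoulli space with shift $\sigma$ and metric $d(x,y)=\theta^{N}$, where $N$ is the first index with $x_N\ne y_N$ (and $d(x,x)=0$), $0<\theta<1$ fixed. Lipschitz is with respect to this metric. A cylinder is a set $\{x\in X: x_1=a_1,\dots,x_m=a_m\}$. For $g:X\to\mathbb{R}$, $g^n(x)=g(x)+g(\sigma x)+\dots+g(\sigma^{n-1}x)$. $\mathrm{Fix}_n=\{x:\sigma^n(x)=x\}$; $\mathrm{PER}=\bigcup_{n\ge1}\mathrm{Fix}_n$; $n_x$ is the minimal period of $x\in\mathrm{PER}$. $P(\cdot)$ is topological pressure for $\sigma$. $\beta(f)=\sup_{\nu}\int f\,d\nu$ over $\sigma$-invariant Borel probabilities $\nu$. For $x\in\mathrm{PER}$,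 $I(x)=n_x\beta(f)-f^{n_x}(x)\ (\ge 0)$. For $x\in X$, $$\widetilde I(x)=\lim_{\epsilon\to0}\Big(\inf\{I(y): y\in\mathrm{PER},\ d(y,x)\le\epsilon\}\Big)\in[0,\infty].$$ For $c>0$, $s\in(0,1)$, $\mu_{c,s}$ is the $\sigma$-invariant probability on $X$ given by $$\int g\,d\mu_{c,s}=\frac{\sum_{n=1}^{\infty}\sum_{x\in \mathrm{Fix}_{n}}e^{c s f^{n}(x)-nP(cf)}\frac{g^{n}(x)}{n}}{\sum_{n=1}^{\infty}\sum_{x\in \mathrm{Fix}_{n}}e^{c s f^{n}(x)-nP(cf)}}$$ for continuous $g$ (the series converge since $P(csf-P(cf))<0$). *)

theory Defs
  imports "HOL-Probability.Probability"
begin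

text \<open>
  Points of the full shift on \<open>d\<close> symbols are functions \<open>nat \<Rightarrow> nat\<close> with values in
  \<open>{1..d}\<close>. Sequences are indexed from 0, so the coordinate \<open>x\<^sub>N\<close> (\<open>N \<ge> 1\<close>) is \<open>x (N - 1)\<close>.
\<close>

definition shift_space :: "nat \<Rightarrow> (nat \<Rightarrow> nat) set" where
  "shift_space d = {x. \<forall>i. x i \<in> {1..d}}"

definition shift :: "(nat \<Rightarrow> nat) \<Rightarrow> nat \<Rightarrow> nat" where
  "shift x = (\<lambda>n. x (Suc n))"

definition shift_dist :: "real \<Rightarrow> (nat \<Rightarrow> nat) \<Rightarrow> (nat \<Rightarrow> nat) \<Rightarrow> real" where
  "shift_dist \<theta> x y = (if x = y then 0 else \<theta> ^ Suc (LEAST i. x i \<noteq> y i))"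

definition shift_lipschitz :: "nat \<Rightarrow> real \<Rightarrow> ((nat \<Rightarrow> nat) \<Rightarrow> real) \<Rightarrow> bool" where
  "shift_lipschitz d \<theta> f \<longleftrightarrow>
     (\<exists>C. \<forall>x\<in>shift_space d. \<forall>y\<in>shift_space d. \<bar>f x - f y\<bar> \<le> C * shift_dist \<theta> x y)"

definition cylinder :: "nat \<Rightarrow> nat list \<Rightarrow> (nat \<Rightarrow> nat) set" where
  "cylinder d w = {x \<in> shift_space d. \<forall>i<length w. x i = w ! i}"

definition birkhoff_sum :: "('a \<Rightarrow> 'a) \<Rightarrow> nat \<Rightarrow> ('a \<Rightarrow> real) \<Rightarrow> 'a \<Rightarrow> real" where
  "birkhoff_sum T n g x = (\<Sum>i<n. g ((T ^^ i) x))"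

definition fix_pts :: "nat \<Rightarrow> nat \<Rightarrow> (nat \<Rightarrow> nat) set" where
  "fix_pts d n = {x \<in> shift_space d. (shift ^^ n) x = x}"

definition per_pts :: "nat \<Rightarrow> (nat \<Rightarrow> nat) set" where
  "per_pts d = (\<Union>n\<in>{1..}. fix_pts d n)"

definition min_period :: "(nat \<Rightarrow> nat) \<Rightarrow> nat" where
  "min_period x = (LEAST n. n \<ge> 1 \<and> (shift ^^ n) x = x)"


text \<open>
  Topological pressure of a map \<open>T\<close> on a compact metric space \<open>(S, D)\<close>, defined through
  \<open>(n, \<epsilon>)\<close>-separated sets. For compact \<open>S\<close> and continuous \<open>T\<close> and \<open>g\<close>, the sums over
  \<open>(n, \<epsilon>)\<close>-separated sets are bounded, so that the real supremum is meaningful.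
\<close>

definition separated_set ::
    "'a set \<Rightarrow> ('a \<Rightarrow> 'a \<Rightarrow> real) \<Rightarrow> ('a \<Rightarrow> 'a) \<Rightarrow> nat \<Rightarrow> real \<Rightarrow> 'a set \<Rightarrow> bool" where
  "separated_set S D T n \<epsilon> E \<longleftrightarrow> finite E \<and> E \<subseteq> S \<and>
     (\<forall>x\<in>E. \<forall>y\<in>E. x \<noteq> y \<longrightarrow> (\<exists>i<n. D ((T ^^ i) x) ((T ^^ i) y) > \<epsilon>))"

definition separated_sum ::
    "'a set \<Rightarrow> ('a \<Rightarrow> 'a \<Rightarrow> real) \<Rightarrow> ('a \<Rightarrow> 'a) \<Rightarrow> ('a \<Rightarrow> real) \<Rightarrow> nat \<Rightarrow> real \<Rightarrow> real" where
  "separated_sum S D T g n \<epsilon> =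
     (SUP E\<in>{E. separated_set S D T n \<epsilon> E}. \<Sum>x\<in>E. exp (birkhoff_sum T n g x))"

definition topological_pressure ::
    "'a set \<Rightarrow> ('a \<Rightarrow> 'a \<Rightarrow> real) \<Rightarrow> ('a \<Rightarrow> 'a) \<Rightarrow> ('a \<Rightarrow> real) \<Rightarrow> ereal" where
  "topological_pressure S D T g =
     Lim (at_right 0)
       (\<lambda>\<epsilon>. limsup (\<lambda>n. ereal (ln (separated_sum S D T g n \<epsilon>) / real n)))"

definition pressure :: "nat \<Rightarrow> real \<Rightarrow> ((nat \<Rightarrow> nat) \<Rightarrow> real) \<Rightarrow> real" where
  "pressure d \<theta> g =
     real_of_ereal (topological_pressure (shift_space d) (shift_dist \<theta>) shift g)"


text \<open>
  The topology on \<open>nat \<Rightarrow> nat\<close> is the product of the discrete topologies; on the shift space it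
  is the topology induced by \<open>shift_dist \<theta>\<close> for every \<open>0 < \<theta> < 1\<close>.
\<close>

definition invariant_probs :: "nat \<Rightarrow> (nat \<Rightarrow> nat) measure set" where
  "invariant_probs d = {M. prob_space M \<and> sets M = sets (restrict_space borel (shift_space d)) \<and>
     distr M M shift = M}"

definition max_mean :: "nat \<Rightarrow> ((nat \<Rightarrow> nat) \<Rightarrow> real) \<Rightarrow> real" where
  "max_mean d f = (SUP M\<in>invariant_probs d. integral\<^sup>L M f)"

definition per_rate :: "nat \<Rightarrow> ((nat \<Rightarrow> nat) \<Rightarrow> real) \<Rightarrow> (nat \<Rightarrow> nat) \<Rightarrow> real" where
  "per_rate d f x =
     real (min_period x) * max_mean d f - birkhoff_sum shift (min_period x) f x"

definition deviation_fun ::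
    "nat \<Rightarrow> real \<Rightarrow> ((nat \<Rightarrow> nat) \<Rightarrow> real) \<Rightarrow> (nat \<Rightarrow> nat) \<Rightarrow> ereal" where
  "deviation_fun d \<theta> f x =
     Lim (at_right 0)
       (\<lambda>\<epsilon>. INF y\<in>{y \<in> per_pts d. shift_dist \<theta> y x \<le> \<epsilon>}. ereal (per_rate d f y))"

definition lower_semicont_on :: "'a::topological_space set \<Rightarrow> ('a \<Rightarrow> ereal) \<Rightarrow> bool" where
  "lower_semicont_on S h \<longleftrightarrow> (\<forall>x\<in>S. h x \<le> Liminf (at x within S) h)"


definition zeta_weight ::
    "nat \<Rightarrow> real \<Rightarrow> ((nat \<Rightarrow> nat) \<Rightarrow> real) \<Rightarrow> real \<Rightarrow> real \<Rightarrow> nat \<Rightarrow> (nat \<Rightarrow> nat) \<Rightarrow> real" where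
  "zeta_weight d \<theta> f c s n x =
     exp (c * s * birkhoff_sum shift n f x - real n * pressure d \<theta> (\<lambda>y. c * f y))"

definition zeta_mean ::
    "nat \<Rightarrow> real \<Rightarrow> ((nat \<Rightarrow> nat) \<Rightarrow> real) \<Rightarrow> real \<Rightarrow> real \<Rightarrow> ((nat \<Rightarrow> nat) \<Rightarrow> real) \<Rightarrow> real" where
  "zeta_mean d \<theta> f c s g =
     (\<Sum>n. \<Sum>x\<in>fix_pts d (Suc n).
        zeta_weight d \<theta> f c s (Suc n) x * (birkhoff_sum shift (Suc n) g x / real (Suc n))) /
     (\<Sum>n. \<Sum>x\<in>fix_pts d (Suc n). zeta_weight d \<theta> f c s (Suc n) x)"

definition zeta_measure ::
    "nat \<Rightarrow> real \<Rightarrow> ((nat \<Rightarrow> nat) \<Rightarrow> real) \<Rightarrow> real \<Rightarrow> real \<Rightarrow> (nat \<Rightarrow> nat) measure" where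
  "zeta_measure d \<theta> f c s =
     (THE M. M \<in> invariant_probs d \<and>
        (\<forall>g. continuous_on (shift_space d) g \<longrightarrow> integral\<^sup>L M g = zeta_mean d \<theta> f c s g))"

end

theory Submission
  imports Defs
begin

text \<open>
  Let \<open>Z\<^sub>n(c)\<close> be the sum of \<open>exp (c f\<^sup>n(x))\<close> over \<open>Fix\<^sub>n\<close>. Gluing periodic points that start with a common
  word of length \<open>q\<close> is nearly additive for Birkhoff sums, with an error of order \<open>\<theta>\<^sup>q\<close>, and yields
  \<open>Z\<^sub>n(c) \<le> d\<^sup>q exp (2 c K \<theta>\<^sup>q + n P(c f))\<close> for all \<open>n\<close> and \<open>q\<close>. Letting \<open>q\<close> grow makes the distortion
  subexponential in \<open>c\<close> although the potential is \<open>c f\<close>. If \<open>J\<close> is the infimum of \<open>I\<close> over the periodic points of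
  a cylinder, then \<open>c f\<^sup>n \<le> (1 - \<eta>) c (n \<beta>(f) - J) + \<eta> c f\<^sup>n\<close> there. Since \<open>P(c f) - c \<beta>(f)\<close> is nonincreasing and
  nonnegative, its values at \<open>\<eta> c\<close> and \<open>c\<close> become arbitrarily close, and the factor
  \<open>exp (- c (1 - s) n min f)\<close> absorbs what is left in the sum over \<open>n\<close>. A single periodic orbit gives the matching
  lower bound, and closing up almost maximizing orbits shows that the infimum of \<open>I\<close> over all periodic points is
  \<open>0\<close>, so that the normalizing series is negligible on the exponential scale.
\<close>

section \<open>Periodic points of the full shift\<close>

lemma shift_funpow: "(shift ^^ n) x = (\<lambda>i. x (n + i))"
  by (induction n arbitrary: x) (auto simp: shift_def funpow_swap1 fun_eq_iff)

lemma shift_funpow_space: "x \<in> shift_space d \<Longrightarrow> (shift ^^ n) x \<in> shift_space d"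
  by (auto simp: shift_funpow shift_space_def)

lemma shift_space_shift: "x \<in> shift_space d \<Longrightarrow> shift x \<in> shift_space d"
  using shift_funpow_space[of x d 1] by simp

lemma fix_pts_iff: "x \<in> fix_pts d n \<longleftrightarrow> x \<in> shift_space d \<and> (\<forall>i. x (n + i) = x i)"
  by (auto simp: fix_pts_def shift_funpow fun_eq_iff)

lemma fix_pts_space: "x \<in> fix_pts d n \<Longrightarrow> x \<in> shift_space d"
  by (simp add: fix_pts_iff)

lemma periodic_mod:
  fixes x :: "nat \<Rightarrow> 'a"
  assumes "\<And>i. x (n + i) = x i"
  shows "x (i mod n) = x i"
proof -
  have "x (k * n + j) = x j" for k j
    by (induction k) (use assms in \<open>auto simp: add.assoc\<close>)
  from this[of "i div n" "i mod n"] show ?thesis by simp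
qed

lemma fix_pts_eqI:
  assumes "x \<in> fix_pts d n" "y \<in> fix_pts d n" "n \<ge> 1" "\<And>i. i < n \<Longrightarrow> x i = y i"
  shows "x = y"
proof
  fix i
  have "x (i mod n) = x i"
    by (rule periodic_mod) (use assms(1) in \<open>auto simp: fix_pts_iff\<close>)
  moreover have "y (i mod n) = y i"
    by (rule periodic_mod) (use assms(2) in \<open>auto simp: fix_pts_iff\<close>)
  ultimately show "x i = y i" using assms(3) assms(4)[of "i mod n"] by simp
qed

lemma const_fix_pts: "d \<ge> 1 \<Longrightarrow> (\<lambda>_. 1) \<in> fix_pts d n"
  by (auto simp: fix_pts_iff shift_space_def)

lemma finite_words: "finite {xs. set xs \<subseteq> {1..d::nat} \<and> length xs = n}"
  and card_words: "card {xs. set xs \<subseteq> {1..d::nat} \<and> length xs = n} = d ^ n"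
  using finite_lists_length_eq[of "{1..d}" n] card_lists_length_eq[of "{1..d}" n] by auto

lemma prefix_eq_iff: "map x [0..<q] = map y [0..<q] \<longleftrightarrow> (\<forall>i<q. x i = y i)"
  by (auto simp: list_eq_iff_nth_eq)

lemma prefix_words: "x \<in> shift_space d \<Longrightarrow> map x [0..<q] \<in> {xs. set xs \<subseteq> {1..d} \<and> length xs = q}"
  by (auto simp: shift_space_def)

lemma inj_on_prefix_fix_pts: "n \<ge> 1 \<Longrightarrow> inj_on (\<lambda>x. map x [0..<n]) (fix_pts d n)"
  by (rule inj_onI) (auto intro: fix_pts_eqI simp: prefix_eq_iff simp del: map_eq_conv)

lemma finite_fix_pts: "n \<ge> 1 \<Longrightarrow> finite (fix_pts d n)"
  and card_fix_pts_le: "n \<ge> 1 \<Longrightarrow> card (fix_pts d n) \<le> d ^ n"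
proof -
  have sub: "(\<lambda>x. map x [0..<n]) ` fix_pts d n \<subseteq> {xs. set xs \<subseteq> {1..d} \<and> length xs = n}"
    using prefix_words fix_pts_space by blast
  show "n \<ge> 1 \<Longrightarrow> finite (fix_pts d n)"
    by (rule inj_on_finite[OF inj_on_prefix_fix_pts sub finite_words])
  show "n \<ge> 1 \<Longrightarrow> card (fix_pts d n) \<le> d ^ n"
    using card_inj_on_le[OF inj_on_prefix_fix_pts sub finite_words] by (simp only: card_words)
qed

definition repeat_prefix :: "nat \<Rightarrow> (nat \<Rightarrow> 'a) \<Rightarrow> nat \<Rightarrow> 'a" where
  "repeat_prefix n x = (\<lambda>i. x (i mod n))"

lemma repeat_prefix_fix_pts: "x \<in> shift_space d \<Longrightarrow> repeat_prefix n x \<in> fix_pts d n"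
  by (auto simp: fix_pts_iff repeat_prefix_def shift_space_def)

text \<open>The first \<open>q\<close> symbols recur at time \<open>n\<close>, so agreement of
  \<open>x\<close> with its periodization propagates past the first period. These \<open>q\<close>
  extra coordinates are what makes closing up cheap in \<open>distortion\<close>.\<close>

lemma repeat_prefix_eq:
  assumes "n \<ge> 1" "\<And>i. i < q \<Longrightarrow> x (n + i) = x i" "i < n + q"
  shows "repeat_prefix n x i = x i"
  using assms(3)
proof (induction i rule: less_induct)
  case (less i)
  show ?case
  proof (cases "i < n")
    case False
    then have "repeat_prefix n x (i - n) = x (i - n)" "i - n < q"
      using less assms(1) by auto
    then show ?thesis using False assms(2)[of "i - n"]
      by (simp add: repeat_prefix_def le_mod_geq)
  qed (simp add: repeat_prefix_def)
qed

section \<open>Birkhoff sums along periodic orbits\<close>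

lemma birkhoff_sum_add:
  "birkhoff_sum shift (n + m) f x = birkhoff_sum shift n f x + birkhoff_sum shift m f ((shift ^^ n) x)"
proof -
  have "birkhoff_sum shift (n + m) f x = (\<Sum>i<n. f ((shift ^^ i) x)) + (\<Sum>i\<in>{n..<n+m}. f ((shift ^^ i) x))"
    unfolding birkhoff_sum_def
    by (subst sum.union_disjoint[symmetric]) (auto intro!: sum.cong)
  also have "(\<Sum>i\<in>{n..<n+m}. f ((shift ^^ i) x)) = (\<Sum>i<m. f ((shift ^^ i) ((shift ^^ n) x)))"
    by (rule sum.reindex_bij_witness[of _ "\<lambda>i. i + n" "\<lambda>i. i - n"])
       (auto simp: funpow_add[symmetric, THEN fun_cong, unfolded comp_def])
  finally show ?thesis by (simp add: birkhoff_sum_def)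
qed

text \<open>The sum of length \<open>i + n\<close> can be split after \<open>i\<close> or after
  \<open>n\<close> terms, and periodicity identifies the two blocks of length \<open>i\<close>.
  Hence the weights of periodic points are constant along orbits.\<close>

lemma birkhoff_sum_shift_fix:
  assumes "x \<in> fix_pts d n" "n \<ge> 1"
  shows "birkhoff_sum shift n f ((shift ^^ i) x) = birkhoff_sum shift n f x"
proof -
  have "birkhoff_sum shift (i + n) f x = birkhoff_sum shift (n + i) f x" by (simp add: add.commute)
  then show ?thesis using assms(1) by (simp only: birkhoff_sum_add) (simp add: fix_pts_def)
qed

lemma min_period_fix_pts:
  assumes "x \<in> fix_pts d n" "n \<ge> 1"
  shows "min_period x \<ge> 1" "x \<in> fix_pts d (min_period x)" "\<exists>k\<ge>1. n = k * min_period x"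
proof -
  have *: "min_period x \<ge> 1 \<and> (shift ^^ min_period x) x = x"
    unfolding min_period_def by (rule LeastI[of _ n]) (use assms in \<open>auto simp: fix_pts_def\<close>)
  then show 1: "min_period x \<ge> 1" and 2: "x \<in> fix_pts d (min_period x)"
    using assms by (auto simp: fix_pts_def)
  \<comment> \<open>The remainder acts as a period too, so minimality forces it to be 0.\<close>
  have r: "x (n mod min_period x + i) = x i" for i
  proof -
    have per: "x (min_period x + i) = x i" for i using 2 by (simp add: fix_pts_iff)
    have *: "x (j mod min_period x) = x j" for j by (rule periodic_mod) (rule per)
    have "x (n mod min_period x + i) = x ((n mod min_period x + i) mod min_period x)"
      by (simp only: *)
    also have "\<dots> = x ((n + i) mod min_period x)" by (simp add: mod_add_left_eq)
    also have "\<dots> = x (n + i)" by (simp only: *)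
    finally show ?thesis using assms by (simp add: fix_pts_iff)
  qed
  have "n mod min_period x = 0"
  proof (rule ccontr)
    assume "n mod min_period x \<noteq> 0"
    then have "min_period x \<le> n mod min_period x"
      unfolding min_period_def using r
      by (intro Least_le) (auto simp: shift_funpow min_period_def)
    moreover have "n mod min_period x < min_period x" using 1 by (intro mod_less_divisor) simp
    ultimately show False by simp
  qed
  then have "n = (n div min_period x) * min_period x"
    by (metis add.right_neutral div_mult_mod_eq)
  moreover have "n div min_period x \<ge> 1"
    using calculation assms(2) by (metis less_one mult_is_0 not_less)
  ultimately show "\<exists>k\<ge>1. n = k * min_period x" by blast
qed

lemma birkhoff_sum_mult:
  assumes "(shift ^^ n) x = x"
  shows "birkhoff_sum shift (k * n) f x = real k * birkhoff_sum shift n f x"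
proof (induction k)
  case 0
  then show ?case by (simp add: birkhoff_sum_def)
next
  case (Suc k)
  then show ?case using assms by (simp add: birkhoff_sum_add algebra_simps)
qed

section \<open>The ultrametric and the product topology\<close>

lemma shift_dist_le_iff:
  assumes "0 < \<theta>" "\<theta> < 1"
  shows "shift_dist \<theta> x y \<le> \<theta> ^ Suc n \<longleftrightarrow> (\<forall>i<n. x i = y i)"
proof (cases "x = y")
  case False
  let ?N = "LEAST i. x i \<noteq> y i"
  from False have N: "x ?N \<noteq> y ?N" by (intro LeastI_ex[of "\<lambda>i. x i \<noteq> y i"]) auto
  \<comment> \<open>Coordinates start at 0, so a first disagreement at \<open>?N\<close> means
    distance \<open>\<theta> ^ Suc ?N\<close>.\<close>
  have "shift_dist \<theta> x y \<le> \<theta> ^ Suc n \<longleftrightarrow> n \<le> ?N"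
    using False assms by (simp add: shift_dist_def power_decreasing_iff)
  also have "\<dots> \<longleftrightarrow> (\<forall>i<n. x i = y i)"
    using N not_less_Least[of _ "\<lambda>i. x i \<noteq> y i"] by (metis (mono_tags, lifting) leI order_less_le_trans)
  finally show ?thesis .
qed (use assms in \<open>simp add: shift_dist_def\<close>)

lemma shift_dist_nonneg: "0 < \<theta> \<Longrightarrow> 0 \<le> shift_dist \<theta> x y"
  by (simp add: shift_dist_def)

text \<open>If \<open>x\<close> and \<open>z\<close> first differ at \<open>?N\<close> and both were
  closer to \<open>y\<close> than \<open>\<theta> ^ Suc ?N\<close>, then both would agree with
  \<open>y\<close> at \<open>?N\<close>.\<close>

lemma shift_dist_ultra:
  assumes "0 < \<theta>" "\<theta> < 1" "shift_dist \<theta> x y \<le> e" "shift_dist \<theta> y z \<le> e"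
  shows "shift_dist \<theta> x z \<le> e"
proof (cases "x = z \<or> y = z \<or> x = y")
  case True
  then show ?thesis using assms shift_dist_nonneg[of \<theta> x y] by (auto simp: shift_dist_def[of \<theta> z z])
next
  case False
  let ?N = "LEAST i. x i \<noteq> z i"
  from False have N: "x ?N \<noteq> z ?N" by (intro LeastI_ex[of "\<lambda>i. x i \<noteq> z i"]) auto
  have D: "shift_dist \<theta> x z = \<theta> ^ Suc ?N" using False by (simp add: shift_dist_def)
  show ?thesis
  proof (rule ccontr)
    assume "\<not> ?thesis"
    then have *: "shift_dist \<theta> x y < \<theta> ^ Suc ?N" "shift_dist \<theta> y z < \<theta> ^ Suc ?N" using D assms by auto
    have "u ?N = v ?N" if "shift_dist \<theta> u v < \<theta> ^ Suc ?N" "u \<noteq> v" for u v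
    proof -
      have "(LEAST i. u i \<noteq> v i) > ?N"
        using that assms by (simp add: shift_dist_def power_strict_decreasing_iff)
      then show ?thesis using not_less_Least by blast
    qed
    then show False using N * False by metis
  qed
qed

lemma open_prefix: "open {y :: nat \<Rightarrow> nat. \<forall>i<n. y i = x i}"
proof -
  have "open {y :: nat \<Rightarrow> nat. y i = x i}" for i
  proof -
    have "open ((\<lambda>y :: nat \<Rightarrow> nat. y i) -` {x i})"
      by (intro open_vimage discrete_topology_class.open_discrete continuous_on_product_coordinates)
    then show ?thesis by (simp add: vimage_def)
  qed
  then have "open (\<Inter>i\<in>{..<n}. {y :: nat \<Rightarrow> nat. y i = x i})" by auto
  moreover have "(\<Inter>i\<in>{..<n}. {y :: nat \<Rightarrow> nat. y i = x i}) = {y. \<forall>i<n. y i = x i}" by auto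
  ultimately show ?thesis by simp
qed

lemma compact_shift_space: "compact (shift_space d)"
proof -
  have "compactin (product_topology (\<lambda>i::nat. euclidean :: nat topology) UNIV) (PiE UNIV (\<lambda>_. {1..d}))"
    by (subst compactin_PiE) (simp add: finite_imp_compact)
  then show ?thesis
    by (simp add: euclidean_product_topology shift_space_def PiE_def Pi_def)
qed

lemma continuous_shift: "continuous_on S shift"
  unfolding shift_def by (intro continuous_on_coordinatewise_then_product continuous_on_subset[OF continuous_on_product_coordinates]) auto

section \<open>Bounded distortion and sums over periodic points\<close>

locale positive_lipschitz_potential =
  fixes d :: nat and \<theta> C :: real and f :: "(nat \<Rightarrow> nat) \<Rightarrow> real"
  assumes d_ge: "d \<ge> 1"
    and theta_pos: "0 < \<theta>" and theta_less: "\<theta> < 1"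
    and C_nonneg: "C \<ge> 0"
    and lip: "\<And>x y. x \<in> shift_space d \<Longrightarrow> y \<in> shift_space d \<Longrightarrow> \<bar>f x - f y\<bar> \<le> C * shift_dist \<theta> x y"
    and pos: "\<And>x. x \<in> shift_space d \<Longrightarrow> f x > 0"
begin

abbreviation X :: "(nat \<Rightarrow> nat) set" where "X \<equiv> shift_space d"
abbreviation Sf :: "nat \<Rightarrow> (nat \<Rightarrow> nat) \<Rightarrow> real" where "Sf n x \<equiv> birkhoff_sum shift n f x"

text \<open>The geometric series of the Lipschitz errors \<open>C * \<theta> ^ i\<close>, which
  bounds the distortion of Birkhoff sums of any length.\<close>

definition K :: real where "K = C / (1 - \<theta>)"

lemma K_nonneg: "K \<ge> 0"
  using C_nonneg theta_less by (simp add: K_def)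

lemma lip_prefix:
  assumes "x \<in> X" "y \<in> X" "\<And>i. i < n \<Longrightarrow> x i = y i"
  shows "\<bar>f x - f y\<bar> \<le> C * \<theta> ^ n"
proof -
  have "shift_dist \<theta> x y \<le> \<theta> ^ Suc n"
    using assms(3) shift_dist_le_iff[OF theta_pos theta_less] by blast
  also have "\<dots> \<le> \<theta> ^ n" using theta_pos theta_less by (simp add: mult_left_le_one_le)
  finally show ?thesis using lip[OF assms(1,2)] C_nonneg
    by (meson mult_left_mono order_trans)
qed

lemma continuous_f: "continuous_on X f"
  unfolding continuous_on_topological
proof (intro ballI allI impI)
  fix x B assume x: "x \<in> X" and B: "open B" "f x \<in> B"
  then obtain e where e: "e > 0" "\<And>z. dist z (f x) < e \<Longrightarrow> z \<in> B" by (meson open_dist)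
  have "(\<lambda>n. C * \<theta> ^ n) \<longlonglongrightarrow> C * 0"
    using theta_pos theta_less by (intro tendsto_intros LIMSEQ_realpow_zero) auto
  then have "\<forall>\<^sub>F n in sequentially. C * \<theta> ^ n < e" using e(1) by (simp add: order_tendsto_iff)
  then obtain n where n: "C * \<theta> ^ n < e" by (auto simp: eventually_sequentially)
  show "\<exists>A. open A \<and> x \<in> A \<and> (\<forall>y\<in>X. y \<in> A \<longrightarrow> f y \<in> B)"
  proof (intro exI conjI ballI impI)
    show "open {y :: nat \<Rightarrow> nat. \<forall>i<n. y i = x i}" by (rule open_prefix)
    fix y assume "y \<in> X" "y \<in> {y. \<forall>i<n. y i = x i}"
    then have "\<bar>f y - f x\<bar> \<le> C * \<theta> ^ n" using x by (intro lip_prefix) auto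
    then show "f y \<in> B" using n by (intro e) (simp add: dist_real_def)
  qed auto
qed

lemma const_X: "(\<lambda>_. 1) \<in> X"
  using d_ge by (simp add: shift_space_def)

text \<open>Some positive lower bound and some upper bound of \<open>f\<close>, not necessarily its
  extrema; they exist by compactness and continuity.\<close>

definition fmin :: real where "fmin = (SOME a. a > 0 \<and> (\<forall>x\<in>X. a \<le> f x))"
definition fmax :: real where "fmax = (SOME b. \<forall>x\<in>X. f x \<le> b)"

lemma fmin_pos: "fmin > 0" and f_ge: "x \<in> X \<Longrightarrow> fmin \<le> f x"
proof -
  obtain z where "z \<in> X" "\<forall>y\<in>X. f z \<le> f y"
    using continuous_attains_inf[OF compact_shift_space _ continuous_f] const_X by blast
  then have "\<exists>a. a > 0 \<and> (\<forall>x\<in>X. a \<le> f x)" using pos by blast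
  from someI_ex[OF this] show "fmin > 0" "x \<in> X \<Longrightarrow> fmin \<le> f x" by (auto simp: fmin_def)
qed

lemma f_le: "x \<in> X \<Longrightarrow> f x \<le> fmax"
proof -
  obtain z where "z \<in> X" "\<forall>y\<in>X. f y \<le> f z"
    using continuous_attains_sup[OF compact_shift_space _ continuous_f] const_X by blast
  then have "\<exists>b. \<forall>x\<in>X. f x \<le> b" by blast
  from someI_ex[OF this] show "x \<in> X \<Longrightarrow> f x \<le> fmax" by (auto simp: fmax_def)
qed

lemma Sf_ge: "x \<in> X \<Longrightarrow> n * fmin \<le> Sf n x"
  unfolding birkhoff_sum_def
  using sum_mono[of "{..<n}" "\<lambda>_. fmin" "\<lambda>i. f ((shift ^^ i) x)"] f_ge shift_funpow_space by simp

lemma Sf_le: "x \<in> X \<Longrightarrow> Sf n x \<le> n * fmax"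
  unfolding birkhoff_sum_def
  using sum_mono[of "{..<n}" "\<lambda>i. f ((shift ^^ i) x)" "\<lambda>_. fmax"] f_le shift_funpow_space by simp

lemma Sf_nonneg: "x \<in> X \<Longrightarrow> 0 \<le> Sf n x"
  using Sf_ge[of x n] fmin_pos by (meson mult_nonneg_nonneg of_nat_0_le_iff order_less_imp_le order_trans)

text \<open>After \<open>i\<close> steps the orbits still agree on \<open>n - i + q\<close>
  coordinates, so the errors are dominated by a geometric series whose largest term is of order
  \<open>\<theta> ^ q\<close>.\<close>

lemma distortion:
  assumes "x \<in> X" "y \<in> X" "\<And>i. i < n + q \<Longrightarrow> x i = y i"
  shows "\<bar>Sf n x - Sf n y\<bar> \<le> K * \<theta> ^ q"
proof -
  \<comment> \<open>The factor \<open>1 - \<theta> ^ n\<close> strengthens the claim so that the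
    induction closes: its increment absorbs the error of the first term.\<close>
  have "\<bar>Sf n x - Sf n y\<bar> \<le> K * \<theta> ^ q * (1 - \<theta> ^ n)"
    using assms
  proof (induction n arbitrary: x y)
    case 0
    then show ?case by (simp add: birkhoff_sum_def)
  next
    case (Suc n)
    have split: "Sf (Suc n) u = f u + Sf n (shift u)" for u
      using birkhoff_sum_add[of 1 n f u] by (simp add: birkhoff_sum_def)
    have 1: "\<bar>f x - f y\<bar> \<le> C * \<theta> ^ (Suc n + q)" using Suc.prems by (intro lip_prefix)
    have 2: "\<bar>Sf n (shift x) - Sf n (shift y)\<bar> \<le> K * \<theta> ^ q * (1 - \<theta> ^ n)"
      using Suc.prems by (intro Suc.IH shift_space_shift) (auto simp: shift_def)
    have "C * \<theta> ^ (Suc n + q) = K * \<theta> ^ q * ((1 - \<theta>) * \<theta> ^ Suc n)"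
      using theta_less by (simp add: K_def power_add field_simps)
    also have "\<dots> \<le> K * \<theta> ^ q * ((1 - \<theta>) * \<theta> ^ n)"
      using K_nonneg theta_pos theta_less
      by (intro mult_left_mono) (auto simp: mult_left_le_one_le)
    finally have 3: "C * \<theta> ^ (Suc n + q) \<le> K * \<theta> ^ q * ((1 - \<theta>) * \<theta> ^ n)" .
    have "K * \<theta> ^ q * ((1 - \<theta>) * \<theta> ^ n) + K * \<theta> ^ q * (1 - \<theta> ^ n) = K * \<theta> ^ q * (1 - \<theta> ^ Suc n)"
      by (simp add: algebra_simps)
    then show ?case unfolding split using 1 2 3 by linarith
  qed
  also have "\<dots> \<le> K * \<theta> ^ q * 1"
    using K_nonneg theta_pos by (intro mult_left_mono) auto
  finally show ?thesis by simp
qed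

text \<open>Replaces an orbit segment by a periodic orbit. For \<open>q = 0\<close> the recurrence
  condition is empty and the cost is \<open>K\<close>; a long recurring prefix makes the cost
  small.\<close>

lemma closing:
  assumes "x \<in> X" "n \<ge> 1" "\<And>i. i < q \<Longrightarrow> x (n + i) = x i"
  shows "repeat_prefix n x \<in> fix_pts d n" "\<And>i. i < n + q \<Longrightarrow> repeat_prefix n x i = x i"
    "\<bar>Sf n (repeat_prefix n x) - Sf n x\<bar> \<le> K * \<theta> ^ q"
proof -
  show 1: "repeat_prefix n x \<in> fix_pts d n" using assms by (intro repeat_prefix_fix_pts)
  show 2: "repeat_prefix n x i = x i" if "i < n + q" for i
    using repeat_prefix_eq[of n q x i] assms that by blast
  show "\<bar>Sf n (repeat_prefix n x) - Sf n x\<bar> \<le> K * \<theta> ^ q"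
    using fix_pts_space[OF 1] assms 2 by (intro distortion)
qed

section \<open>Partition functions over periodic points and their near multiplicativity\<close>

definition periodic_sum :: "real \<Rightarrow> nat \<Rightarrow> (nat \<Rightarrow> nat) set \<Rightarrow> real" where
  "periodic_sum c n A = (\<Sum>x\<in>fix_pts d n \<inter> A. exp (c * Sf n x))"

text \<open>Unlike \<open>cylinder\<close>, it is not intersected with the shift space, since it is
  only combined with \<open>fix_pts\<close>.\<close>

definition prefix_set :: "nat list \<Rightarrow> (nat \<Rightarrow> nat) set" where
  "prefix_set v = {x. map x [0..<length v] = v}"

lemma prefix_set_iff: "x \<in> prefix_set v \<longleftrightarrow> (\<forall>i<length v. x i = v ! i)"
  using prefix_eq_iff[of x "length v" "(!) v"] by (simp only: prefix_set_def map_nth mem_Collect_eq)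

text \<open>Gluing one period of \<open>x\<close> to one period of \<open>y\<close> embeds pairs of periodic points starting with the
  word \<open>v\<close> into such points of period \<open>n + m\<close>, at the cost of two distortion constants.\<close>

lemma periodic_sum_mult_le:
  assumes n: "n \<ge> 1" and m: "m \<ge> 1" and c: "c \<ge> 0"
  shows "periodic_sum c n (prefix_set v) * periodic_sum c m (prefix_set v) \<le>
    exp (2 * c * K * \<theta> ^ length v) * periodic_sum c (n + m) (prefix_set v)"
proof -
  let ?q = "length v"
  define glue where "glue x y = (\<lambda>i. if i < n then x i else y (i - n) :: nat)" for x y :: "nat \<Rightarrow> nat"
  define Z where "Z = (\<lambda>(x, y). repeat_prefix (n + m) (glue x y))"
  define F where "F = (\<lambda>k. fix_pts d k \<inter> prefix_set v)"
  have fin: "finite (F k)" if "k \<ge> 1" for k using finite_fix_pts that by (simp add: F_def)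
  have Z: "Z (x, y) \<in> F (n + m) \<and> Sf n x + Sf m y \<le> Sf (n + m) (Z (x, y)) + 2 * K * \<theta> ^ ?q
      \<and> (\<forall>i<n. Z (x, y) i = x i) \<and> (\<forall>i<m. Z (x, y) (n + i) = y i)"
    if x: "x \<in> F n" and y: "y \<in> F m" for x y
  proof -
    let ?u = "glue x y"
    have xX: "x \<in> X" "x (n + i) = x i" and yX: "y \<in> X" "y (m + i) = y i" for i
      using x y by (auto simp: F_def fix_pts_iff)
    have xv: "x i = v ! i" and yv: "y i = v ! i" if "i < ?q" for i
      using x y that by (auto simp: F_def prefix_set_iff)
    have u: "?u \<in> X" using xX yX by (auto simp: glue_def shift_space_def)
    \<comment> \<open>From position \<open>n\<close> on, the glued sequence spells \<open>v\<close>
      through \<open>y\<close>, and \<open>x\<close> spells \<open>v\<close> there by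
      periodicity.\<close>
    have ux: "?u i = x i" if "i < n + ?q" for i
    proof (cases "i < n")
      case False
      then have "x i = x (i - n)" using xX(2)[of "i - n"] by simp
      then show ?thesis using False that xv[of "i - n"] yv[of "i - n"] by (simp add: glue_def)
    qed (simp add: glue_def)
    have su: "(shift ^^ n) ?u = y" by (simp add: shift_funpow glue_def)
    \<comment> \<open>After both blocks the word \<open>v\<close> begins again, so
      \<open>closing\<close> applies with period \<open>n + m\<close>.\<close>
    have rep: "?u (n + m + i) = ?u i" if "i < ?q" for i
      using yX(2)[of i] xv yv ux[of i] that by (simp add: glue_def add.assoc)
    have nm: "n + m \<ge> 1" using n by simp
    note cl = closing[OF u nm rep]
    have Zv: "\<And>i. i < n + m + ?q \<Longrightarrow> Z (x, y) i = ?u i" using cl(2) by (simp add: Z_def)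
    have "Z (x, y) \<in> F (n + m)"
      using cl(1) Zv ux xv by (simp add: F_def prefix_set_iff Z_def)
    \<comment> \<open>The block of \<open>y\<close> is reproduced exactly by \<open>su\<close>; one
      distortion constant comes from the block of \<open>x\<close>, the other from closing
      up.\<close>
    moreover have "Sf n x + Sf m y \<le> Sf (n + m) (Z (x, y)) + 2 * K * \<theta> ^ ?q"
    proof -
      have "\<bar>Sf n ?u - Sf n x\<bar> \<le> K * \<theta> ^ ?q" using u xX ux by (intro distortion) auto
      moreover have "Sf (n + m) ?u = Sf n ?u + Sf m y" by (simp add: birkhoff_sum_add su)
      moreover have "\<bar>Sf (n + m) (Z (x, y)) - Sf (n + m) ?u\<bar> \<le> K * \<theta> ^ ?q"
        using cl(3) by (simp add: Z_def)
      ultimately show ?thesis by linarith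
    qed
    moreover have "\<forall>i<n. Z (x, y) i = x i" using Zv ux by simp
    moreover have "\<forall>i<m. Z (x, y) (n + i) = y i" using Zv by (simp add: glue_def)
    ultimately show ?thesis by blast
  qed
  have inj: "inj_on Z (F n \<times> F m)"
  proof (rule inj_onI, clarify)
    fix x y x' y' assume a: "x \<in> F n" "y \<in> F m" "x' \<in> F n" "y' \<in> F m" and eq: "Z (x, y) = Z (x', y')"
    note ZZ = Z[OF a(1,2)] Z[OF a(3,4)]
    have "x i = x' i" if "i < n" for i
    proof -
      have "x i = Z (x, y) i" using ZZ(1) that by simp
      also have "\<dots> = x' i" unfolding eq using ZZ(2) that by simp
      finally show ?thesis .
    qed
    moreover have "y i = y' i" if "i < m" for i
    proof -
      have "y i = Z (x, y) (n + i)" using ZZ(1) that by simp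
      also have "\<dots> = y' i" unfolding eq using ZZ(2) that by simp
      finally show ?thesis .
    qed
    ultimately show "x = x' \<and> y = y'"
      using fix_pts_eqI[of x d n x'] fix_pts_eqI[of y d m y'] a n m by (auto simp: F_def)
  qed
  have "periodic_sum c n (prefix_set v) * periodic_sum c m (prefix_set v) =
      (\<Sum>p\<in>F n \<times> F m. exp (c * Sf n (fst p)) * exp (c * Sf m (snd p)))"
    by (simp add: periodic_sum_def F_def sum_product sum.cartesian_product case_prod_unfold)
  also have "\<dots> \<le> (\<Sum>p\<in>F n \<times> F m. exp (2 * c * K * \<theta> ^ ?q) * exp (c * Sf (n + m) (Z p)))"
  proof (rule sum_mono)
    fix p assume "p \<in> F n \<times> F m"
    then have "Sf n (fst p) + Sf m (snd p) \<le> Sf (n + m) (Z p) + 2 * K * \<theta> ^ ?q"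
      using Z[of "fst p" "snd p"] by auto
    from mult_left_mono[OF this c]
    show "exp (c * Sf n (fst p)) * exp (c * Sf m (snd p)) \<le> exp (2 * c * K * \<theta> ^ ?q) * exp (c * Sf (n + m) (Z p))"
      by (simp add: exp_add[symmetric] algebra_simps)
  qed
  also have "\<dots> = exp (2 * c * K * \<theta> ^ ?q) * (\<Sum>z\<in>Z ` (F n \<times> F m). exp (c * Sf (n + m) z))"
    by (simp add: sum_distrib_left sum.reindex[OF inj])
  also have "\<dots> \<le> exp (2 * c * K * \<theta> ^ ?q) * (\<Sum>z\<in>F (n + m). exp (c * Sf (n + m) z))"
    using Z n by (intro mult_left_mono sum_mono2 fin) auto
  finally show ?thesis by (simp add: periodic_sum_def F_def)
qed

lemma periodic_sum_power_le:
  assumes n: "n \<ge> 1" and c: "c \<ge> 0" and k: "k \<ge> 1"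
  shows "periodic_sum c n (prefix_set v) ^ k \<le>
    exp (2 * c * K * \<theta> ^ length v) ^ k * periodic_sum c (n * k) (prefix_set v)"
  using k
proof (induction k rule: nat_induct_at_least)
  case base
  \<comment> \<open>Gluing \<open>k\<close> blocks takes only \<open>k - 1\<close> steps; one factor
    that is at least 1 is given away to obtain a clean \<open>k\<close>-th power.\<close>
  have "1 * periodic_sum c n (prefix_set v) \<le> exp (2 * c * K * \<theta> ^ length v) * periodic_sum c n (prefix_set v)"
    using c K_nonneg theta_pos by (intro mult_right_mono) (auto simp: periodic_sum_def intro!: sum_nonneg)
  then show ?case by simp
next
  case (Suc k)
  let ?E = "exp (2 * c * K * \<theta> ^ length v)" and ?Z = "\<lambda>n. periodic_sum c n (prefix_set v)"
  have "?Z n ^ Suc k \<le> ?Z n * (?E ^ k * ?Z (n * k))"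
    using Suc.IH by (simp add: mult_left_mono periodic_sum_def sum_nonneg)
  also have "\<dots> = ?E ^ k * (?Z n * ?Z (n * k))" by simp
  also have "\<dots> \<le> ?E ^ k * (?E * ?Z (n + n * k))"
    using n Suc.hyps c by (intro mult_left_mono periodic_sum_mult_le) auto
  finally show ?case by (simp only: power_Suc mult_Suc_right mult_ac)
qed

section \<open>Growth rate of the partition functions\<close>

definition lnZ_rate :: "real \<Rightarrow> nat \<Rightarrow> real" where
  "lnZ_rate c n = ln (periodic_sum c n UNIV) / n"

text \<open>\<open>pressure_eq_P\<close> identifies this with the topological pressure of
  \<open>c * f\<close> for \<open>c \<ge> 0\<close>. There the limsup is finite by
  \<open>limsup_lnZ_rate\<close>, so passing to a real loses nothing.\<close>

definition P :: "real \<Rightarrow> real" where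
  "P c = real_of_ereal (limsup (\<lambda>n. ereal (lnZ_rate c n)))"

lemma periodic_sum_ge_1: "c \<ge> 0 \<Longrightarrow> n \<ge> 1 \<Longrightarrow> periodic_sum c n UNIV \<ge> 1"
proof -
  assume c: "c \<ge> 0" and n: "n \<ge> 1"
  have "1 \<le> exp (c * Sf n (\<lambda>_. 1))" using c Sf_nonneg[OF const_X] by simp
  also have "\<dots> \<le> periodic_sum c n UNIV"
    unfolding periodic_sum_def using const_fix_pts[OF d_ge] finite_fix_pts[OF n]
    by (intro member_le_sum) auto
  finally show ?thesis .
qed

lemma periodic_sum_le: "c \<ge> 0 \<Longrightarrow> n \<ge> 1 \<Longrightarrow> periodic_sum c n UNIV \<le> real d ^ n * exp (c * (n * fmax))"
proof -
  assume c: "c \<ge> 0" and n: "n \<ge> 1"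
  have "periodic_sum c n UNIV \<le> of_nat (card (fix_pts d n \<inter> UNIV)) * exp (c * (n * fmax))"
    unfolding periodic_sum_def
    by (rule sum_bounded_above) (auto intro!: mult_left_mono Sf_le c dest: fix_pts_space)
  also have "\<dots> \<le> real d ^ n * exp (c * (n * fmax))"
  proof (rule mult_right_mono)
    show "real (card (fix_pts d n \<inter> UNIV)) \<le> real d ^ n"
      using card_fix_pts_le[OF n, of d] by (simp flip: of_nat_power)
  qed simp
  finally show ?thesis .
qed

lemma lnZ_rate_bounds:
  assumes "c \<ge> 0" "n \<ge> 1"
  shows "0 \<le> lnZ_rate c n" "lnZ_rate c n \<le> ln d + c * fmax"
proof -
  show "0 \<le> lnZ_rate c n" using periodic_sum_ge_1[OF assms] by (simp add: lnZ_rate_def)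
  have "ln (periodic_sum c n UNIV) \<le> ln (real d ^ n * exp (c * (n * fmax)))"
    using periodic_sum_ge_1[OF assms] periodic_sum_le[OF assms] d_ge by (subst ln_le_cancel_iff) auto
  also have "\<dots> = n * (ln d + c * fmax)"
    using d_ge by (simp add: ln_mult ln_realpow algebra_simps)
  finally show "lnZ_rate c n \<le> ln d + c * fmax"
    using assms by (simp add: lnZ_rate_def field_simps)
qed

lemma limsup_lnZ_rate: "c \<ge> 0 \<Longrightarrow> limsup (\<lambda>n. ereal (lnZ_rate c n)) = ereal (P c)"
proof -
  assume c: "c \<ge> 0"
  let ?l = "limsup (\<lambda>n. ereal (lnZ_rate c n))"
  have "?l \<le> ereal (ln d + c * fmax)"
    by (rule Limsup_bounded) (auto simp: eventually_sequentially lnZ_rate_bounds c intro!: exI[of _ 1])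
  moreover have "0 \<le> ?l"
    by (rule le_Limsup) (auto simp: eventually_sequentially lnZ_rate_bounds c intro!: exI[of _ 1])
  ultimately show ?thesis unfolding P_def by (cases ?l) auto
qed

lemma P_le_bound:
  assumes "c \<ge> 0" "\<And>n. n \<ge> 1 \<Longrightarrow> lnZ_rate c n \<le> g n" "g \<longlonglongrightarrow> l"
  shows "P c \<le> l"
proof -
  have "ereal (P c) \<le> limsup (\<lambda>n. ereal (g n))"
    unfolding limsup_lnZ_rate[OF assms(1), symmetric]
    by (rule Limsup_mono) (use assms(2) in \<open>auto simp: eventually_sequentially intro!: exI[of _ 1]\<close>)
  also have "\<dots> = ereal l"
    by (rule lim_imp_Limsup) (use assms(3) in auto)
  finally show ?thesis by simp
qed

text \<open>A limsup dominates the limit along any subsequence, so estimates obtained by gluing are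
  only needed at the multiples of \<open>n\<close>.\<close>

lemma P_ge_bound:
  assumes "c \<ge> 0" "n \<ge> 1" "\<And>k. k \<ge> 1 \<Longrightarrow> g k \<le> lnZ_rate c (n * k)" "g \<longlonglongrightarrow> l"
  shows "l \<le> P c"
proof -
  have sm: "strict_mono (\<lambda>k. n * k)" using assms(2) by (auto simp: strict_mono_def)
  have "ereal l = limsup (\<lambda>k. ereal (g k))"
    by (rule lim_imp_Limsup[symmetric]) (use assms(4) in auto)
  also have "\<dots> \<le> limsup ((\<lambda>n. ereal (lnZ_rate c n)) \<circ> (\<lambda>k. n * k))"
    by (rule Limsup_mono) (use assms(3) in \<open>auto simp: eventually_sequentially intro!: exI[of _ 1]\<close>)
  also have "\<dots> \<le> ereal (P c)"
    unfolding limsup_lnZ_rate[OF assms(1), symmetric] by (rule limsup_subseq_mono[OF sm])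
  finally show ?thesis by simp
qed

text \<open>A Fekete type argument: bound the \<open>k\<close>-th power by the sum of period
  \<open>n * k\<close>, take logarithms, divide by \<open>n * k\<close> and let \<open>k\<close>
  grow. The outcome holds for each single \<open>n\<close>, not only asymptotically.\<close>

lemma periodic_sum_prefix_le:
  assumes c: "c \<ge> 0" and n: "n \<ge> 1"
  shows "periodic_sum c n (prefix_set v) \<le> exp (2 * c * K * \<theta> ^ length v + n * P c)"
proof -
  let ?Z = "periodic_sum c n (prefix_set v)" and ?e = "2 * c * K * \<theta> ^ length v"
  have "?Z \<ge> 0" by (auto simp: periodic_sum_def intro!: sum_nonneg)
  \<comment> \<open>There may be no point of period \<open>n\<close> starting with \<open>v\<close>;
    the logarithm requires the other case.\<close>
  then consider "?Z = 0" | "?Z > 0" by linarith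
  then show ?thesis
  proof cases
    case 2
    have "(ln ?Z - ?e) / n \<le> P c"
    proof (rule P_ge_bound[OF c n])
      fix k :: nat assume k: "k \<ge> 1"
      have nk: "n * k \<ge> 1" using n k by simp
      have "?Z ^ k \<le> exp ?e ^ k * periodic_sum c (n * k) (prefix_set v)"
        using periodic_sum_power_le[OF n c k] .
      also have "\<dots> \<le> exp ?e ^ k * periodic_sum c (n * k) UNIV"
        unfolding periodic_sum_def using finite_fix_pts[OF nk]
        by (intro mult_left_mono sum_mono2) auto
      finally have "?Z ^ k \<le> exp ?e ^ k * periodic_sum c (n * k) UNIV" .
      then have "ln (?Z ^ k) \<le> ln (exp ?e ^ k * periodic_sum c (n * k) UNIV)"
        using 2 periodic_sum_ge_1[OF c nk] by (subst ln_le_cancel_iff) auto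
      then have "k * ln ?Z \<le> k * ?e + ln (periodic_sum c (n * k) UNIV)"
        using 2 periodic_sum_ge_1[OF c nk] by (simp add: ln_mult ln_realpow)
      then have "(k * (ln ?Z - ?e)) / (n * k) \<le> lnZ_rate c (n * k)"
        unfolding lnZ_rate_def by (intro divide_right_mono) (auto simp: algebra_simps)
      then show "(ln ?Z - ?e) / n \<le> lnZ_rate c (n * k)"
        using n k by simp
    qed simp
    then have "ln ?Z \<le> ?e + n * P c" using n by (simp add: field_simps)
    then show ?thesis using 2 by (metis exp_le_cancel_iff exp_ln)
  qed simp
qed

text \<open>The factor \<open>d ^ q\<close> bounds the number of prefix classes, each estimated by
  \<open>periodic_sum_prefix_le\<close>. The free \<open>q\<close> trades this factor against the
  distortion.\<close>

lemma periodic_sum_upper: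
  assumes c: "c \<ge> 0" and n: "n \<ge> 1"
  shows "periodic_sum c n UNIV \<le> real d ^ q * exp (2 * c * K * \<theta> ^ q + n * P c)"
proof -
  let ?W = "(\<lambda>x. map x [0..<q]) ` fix_pts d n"
  have W: "?W \<subseteq> {xs. set xs \<subseteq> {1..d} \<and> length xs = q}"
    using prefix_words fix_pts_space by blast
  have "periodic_sum c n UNIV = (\<Sum>v\<in>?W. \<Sum>x | x \<in> fix_pts d n \<and> map x [0..<q] = v. exp (c * Sf n x))"
    unfolding periodic_sum_def using sum.image_gen[OF finite_fix_pts[OF n], of "\<lambda>x. exp (c * Sf n x)" d "\<lambda>x. map x [0..<q]"] by simp
  also have "\<dots> = (\<Sum>v\<in>?W. periodic_sum c n (prefix_set v))"
    unfolding periodic_sum_def by (intro sum.cong) (use W in \<open>auto simp: prefix_set_def\<close>)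
  also have "\<dots> \<le> (\<Sum>v\<in>?W. exp (2 * c * K * \<theta> ^ q + n * P c))"
  proof (rule sum_mono)
    fix v assume "v \<in> ?W"
    then have "length v = q" by auto
    then show "periodic_sum c n (prefix_set v) \<le> exp (2 * c * K * \<theta> ^ q + n * P c)"
      using periodic_sum_prefix_le[OF c n, of v] by simp
  qed
  also have "\<dots> = real (card ?W) * exp (2 * c * K * \<theta> ^ q + n * P c)" by simp
  also have "\<dots> \<le> real (d ^ q) * exp (2 * c * K * \<theta> ^ q + n * P c)"
    using card_mono[OF finite_words W] unfolding card_words
    by (intro mult_right_mono) (simp_all only: of_nat_le_iff exp_ge_zero)
  finally show ?thesis by simp
qed

end

section \<open>Invariant measures and cylinders\<close>

abbreviation shift_borel :: "nat \<Rightarrow> (nat \<Rightarrow> nat) measure" where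
  "shift_borel d \<equiv> restrict_space borel (shift_space d)"

lemma space_shift_borel: "space (shift_borel d) = shift_space d"
  by (simp add: space_restrict_space)

lemma shift_measurable: "shift \<in> shift_borel d \<rightarrow>\<^sub>M shift_borel d"
  by (rule measurable_restrict_space3)
     (auto intro!: borel_measurable_continuous_onI continuous_shift shift_space_shift)

lemma cylinder_eq_open_Int: "cylinder d w = {y. \<forall>i<length w. y i = w ! i} \<inter> shift_space d"
  "open {y :: nat \<Rightarrow> nat. \<forall>i<length w. y i = w ! i}"
  using open_prefix[of "length w" "(!) w"] by (auto simp: cylinder_def)

lemma cylinder_subset: "cylinder d w \<subseteq> shift_space d"
  by (auto simp: cylinder_def)

lemma cylinder_sets: "cylinder d w \<in> sets (shift_borel d)"
  unfolding cylinder_eq_open_Int(1) using cylinder_eq_open_Int(2)[of w]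
  by (auto simp: sets_restrict_space)

text \<open>A basic open set of the product restricts finitely many coordinates, so fixing a long
  enough prefix of \<open>x\<close> stays inside it.\<close>

lemma open_contains_cylinder:
  assumes "open B" "x \<in> B" "x \<in> shift_space d"
  shows "\<exists>w. x \<in> cylinder d w \<and> cylinder d w \<subseteq> B"
proof -
  obtain V where V: "x \<in> (\<Pi>\<^sub>E i\<in>UNIV. V i)" "finite {i. V i \<noteq> (UNIV :: nat set)}" "(\<Pi>\<^sub>E i\<in>UNIV. V i) \<subseteq> B"
    using product_topology_open_contains_basis[of "\<lambda>_. euclidean" UNIV B x] assms(1,2)
    by (auto simp: open_fun_def)
  from V(2) obtain n where n: "\<And>i. V i \<noteq> UNIV \<Longrightarrow> i < n"
    using finite_nat_set_iff_bounded by (metis (mono_tags, lifting) mem_Collect_eq)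
  have "cylinder d (map x [0..<n]) \<subseteq> (\<Pi>\<^sub>E i\<in>UNIV. V i)"
  proof
    fix y assume y: "y \<in> cylinder d (map x [0..<n])"
    have "y i \<in> V i" for i
    proof (cases "V i = UNIV")
      case False
      then have "y i = x i" using n y by (simp add: cylinder_def)
      then show ?thesis using V(1) by auto
    qed simp
    then show "y \<in> (\<Pi>\<^sub>E i\<in>UNIV. V i)" by auto
  qed
  moreover have "x \<in> cylinder d (map x [0..<n])" using assms(3) by (simp add: cylinder_def)
  ultimately show ?thesis using V(3) by blast
qed

text \<open>There are countably many words, so each open set meets the space in a countable union of
  cylinders.\<close>

lemma sets_shift_borel: "sets (shift_borel d) = sigma_sets (shift_space d) (insert {} (range (cylinder d)))"
proof
  let ?E = "insert {} (range (cylinder d))"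
  interpret S: sigma_algebra "shift_space d" "sigma_sets (shift_space d) ?E"
    by (rule sigma_algebra_sigma_sets) (auto simp: cylinder_def)
  show "sigma_sets (shift_space d) ?E \<subseteq> sets (shift_borel d)"
    using sets.sigma_sets_subset[of ?E "shift_borel d"] cylinder_sets
    by (auto simp: space_shift_borel)
  have "B \<inter> shift_space d \<in> sigma_sets (shift_space d) ?E" if "B \<in> sigma_sets UNIV {S. open S}" for B
    using that
  proof (induction B)
    case (Basic B)
    then have "B \<inter> shift_space d = (\<Union>w\<in>{w. cylinder d w \<subseteq> B}. cylinder d w)"
      using open_contains_cylinder[of B _ d] cylinder_subset[of d] by blast
    also have "\<dots> \<in> sigma_sets (shift_space d) ?E"
      by (intro S.countable_UN'') (auto intro: sigma_sets.Basic)
    finally show ?case .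
  next
    case (Compl B)
    have "(UNIV - B) \<inter> shift_space d = shift_space d - (B \<inter> shift_space d)" by auto
    then show ?case using Compl S.compl_sets by metis
  next
    case (Union A)
    then show ?case by (simp only: UN_extend_simps) (intro sigma_sets.Union)
  qed (simp add: sigma_sets.Empty)
  then show "sets (shift_borel d) \<subseteq> sigma_sets (shift_space d) ?E"
    by (auto simp: sets_restrict_space sets_borel Int_commute)
qed

text \<open>Two cylinders are either nested or disjoint.\<close>

lemma cylinder_Int: "cylinder d v \<inter> cylinder d w \<in> insert {} (range (cylinder d))"
proof -
  have *: "cylinder d v \<inter> cylinder d w \<in> insert {} (range (cylinder d))" if "length v \<le> length w" for v w
  proof (cases "\<forall>i<length v. v ! i = w ! i")
    case True
    then have "cylinder d v \<inter> cylinder d w = cylinder d w"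
      using that by (auto simp: cylinder_def)
    then show ?thesis by auto
  next
    case False
    then obtain i where "i < length v" "v ! i \<noteq> w ! i" by blast
    then have "cylinder d v \<inter> cylinder d w = {}" using that by (force simp: cylinder_def)
    then show ?thesis by auto
  qed
  show ?thesis using *[of v w] *[of w v] by (cases "length v \<le> length w") (auto simp: Int_commute)
qed

lemma continuous_indicator_cylinder: "continuous_on (shift_space d) (indicator (cylinder d w) :: _ \<Rightarrow> real)"
proof -
  let ?h = "\<lambda>i k. if k = w ! i then 1 else 0 :: real"
  have "continuous_on (shift_space d) (\<lambda>x. \<Prod>i<length w. ?h i (x i))"
  proof (rule continuous_on_prod)
    fix i
    have "continuous_on (shift_space d) (?h i \<circ> (\<lambda>x. x i))"
      by (intro continuous_on_compose Topological_Spaces.continuous_on_discrete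
          continuous_on_subset[OF continuous_on_product_coordinates]) auto
    then show "continuous_on (shift_space d) (\<lambda>x. ?h i (x i))" by (simp add: comp_def)
  qed
  also have "continuous_on (shift_space d) (\<lambda>x. \<Prod>i<length w. ?h i (x i)) \<longleftrightarrow> ?thesis"
    by (rule continuous_on_cong) (auto simp: indicator_def cylinder_def)
  finally show ?thesis .
qed

text \<open>Indicators of cylinders are continuous, and cylinders form an intersection-stable
  generator. This yields both the invariance of embedded distributions and the uniqueness behind
  \<open>zeta_measure\<close>.\<close>

lemma measure_eq_of_integrals:
  assumes "prob_space M" "prob_space N" "sets M = sets (shift_borel d)" "sets N = sets (shift_borel d)"
    and eq: "\<And>g :: _ \<Rightarrow> real. continuous_on (shift_space d) g \<Longrightarrow> integral\<^sup>L M g = integral\<^sup>L N g"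
  shows "M = N"
proof -
  interpret M: prob_space M by fact
  interpret N: prob_space N by fact
  have X: "cylinder d [] = shift_space d" by (simp add: cylinder_def)
  have cyl: "emeasure M (cylinder d w) = emeasure N (cylinder d w)" for w
  proof -
    have "integral\<^sup>L M (indicator (cylinder d w)) = measure M (cylinder d w)"
      using cylinder_sets[of d w] assms(3) by (simp add: M.emeasure_eq_measure)
    moreover have "integral\<^sup>L N (indicator (cylinder d w)) = measure N (cylinder d w)"
      using cylinder_sets[of d w] assms(4) by (simp add: N.emeasure_eq_measure)
    ultimately show ?thesis
      using eq[OF continuous_indicator_cylinder, of w] by (simp add: M.emeasure_eq_measure N.emeasure_eq_measure)
  qed
  show ?thesis
  proof (rule measure_eqI_generator_eq)
    show "Int_stable (insert {} (range (cylinder d)))"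
      using cylinder_Int by (auto simp: Int_stable_def)
    show "sets M = sigma_sets (shift_space d) (insert {} (range (cylinder d)))"
      "sets N = sigma_sets (shift_space d) (insert {} (range (cylinder d)))"
      using assms(3,4) sets_shift_borel by auto
    show "insert {} (range (cylinder d)) \<subseteq> Pow (shift_space d)" by (auto simp: cylinder_def)
    show "range (\<lambda>_::nat. cylinder d []) \<subseteq> insert {} (range (cylinder d))" by auto
  qed (use cyl X in auto)
qed

section \<open>Maximizing measures and periodic orbits\<close>

text \<open>The orbit measure, counted with multiplicity. Discrete measures are handled as
  probability mass functions and moved to the Borel sets of the shift space only at the end.\<close>

definition orbit_pmf :: "nat \<Rightarrow> (nat \<Rightarrow> nat) \<Rightarrow> (nat \<Rightarrow> nat) pmf" where
  "orbit_pmf n x = map_pmf (\<lambda>i. (shift ^^ i) x) (pmf_of_set {..<n})"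

lemma expectation_orbit_pmf:
  "n \<ge> 1 \<Longrightarrow> measure_pmf.expectation (orbit_pmf n x) g = birkhoff_sum shift n g x / real n" for g :: "_ \<Rightarrow> real"
  by (simp add: orbit_pmf_def birkhoff_sum_def integral_pmf_of_set lessThan_empty_iff)

lemma set_orbit_pmf:
  "n \<ge> 1 \<Longrightarrow> x \<in> shift_space d \<Longrightarrow> set_pmf (orbit_pmf n x) \<subseteq> shift_space d"
  by (auto simp: orbit_pmf_def shift_funpow_space)

lemma map_shift_orbit_pmf:
  assumes n: "n \<ge> 1" and x: "x \<in> fix_pts d n"
  shows "map_pmf shift (orbit_pmf n x) = orbit_pmf n x"
proof -
  \<comment> \<open>The successor modulo \<open>n\<close>: on a periodic orbit the shift merely
    permutes the indices in this way.\<close>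
  let ?r = "\<lambda>i. if Suc i = n then 0 else Suc i"
  have "bij_betw ?r {..<n} {..<n}"
    by (rule bij_betw_byWitness[where f' = "\<lambda>i. if i = 0 then n - 1 else i - 1"]) (use n in auto)
  then have r: "map_pmf ?r (pmf_of_set {..<n}) = pmf_of_set {..<n}"
    using n by (intro map_pmf_of_set_bij_betw) (auto simp: lessThan_empty_iff)
  have s: "(shift ^^ ?r i) x = shift ((shift ^^ i) x)" for i
    using x by (auto simp: fix_pts_def)
  have "orbit_pmf n x = map_pmf (\<lambda>i. (shift ^^ ?r i) x) (pmf_of_set {..<n})"
    unfolding orbit_pmf_def by (subst (1) r[symmetric]) (simp only: map_pmf_comp)
  also have "\<dots> = map_pmf shift (orbit_pmf n x)"
    unfolding s orbit_pmf_def by (simp only: map_pmf_comp)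
  finally show ?thesis ..
qed

context positive_lipschitz_potential
begin

text \<open>The constant sequence is a junk value: the embedded distributions will be supported in \<open>X\<close>.\<close>

definition embed_measure_pmf :: "(nat \<Rightarrow> nat) pmf \<Rightarrow> (nat \<Rightarrow> nat) measure" where
  "embed_measure_pmf p = distr (measure_pmf p) (shift_borel d) (\<lambda>x. if x \<in> X then x else (\<lambda>_. 1))"

lemma integral_embed_measure_pmf:
  assumes "set_pmf p \<subseteq> X" "g \<in> borel_measurable (shift_borel d)"
  shows "integral\<^sup>L (embed_measure_pmf p) g = measure_pmf.expectation p (g :: _ \<Rightarrow> real)"
proof -
  have "integral\<^sup>L (embed_measure_pmf p) g = measure_pmf.expectation p (\<lambda>x. g (if x \<in> X then x else (\<lambda>_. 1)))"
    unfolding embed_measure_pmf_def using const_X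
    by (intro integral_distr assms) (auto simp: space_shift_borel)
  also have "\<dots> = measure_pmf.expectation p g"
    by (intro integral_cong_AE) (use assms in \<open>auto simp: AE_measure_pmf_iff\<close>)
  finally show ?thesis .
qed

text \<open>Invariance is tested on continuous functions, where it reduces to invariance of
  \<open>p\<close>.\<close>

lemma embed_measure_pmf_invariant:
  assumes "set_pmf p \<subseteq> X" "map_pmf shift p = p"
  shows "embed_measure_pmf p \<in> invariant_probs d"
proof -
  let ?M = "embed_measure_pmf p"
  have sets: "sets ?M = sets (shift_borel d)" by (simp add: embed_measure_pmf_def)
  have prob: "prob_space ?M"
    unfolding embed_measure_pmf_def using const_X
    by (intro measure_pmf.prob_space_distr) (auto simp: space_shift_borel)
  have sh: "shift \<in> ?M \<rightarrow>\<^sub>M ?M" "shift \<in> ?M \<rightarrow>\<^sub>M shift_borel d"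
    using shift_measurable sets measurable_cong_sets by blast+
  have "distr ?M ?M shift = ?M"
  proof (rule measure_eq_of_integrals)
    show "prob_space (distr ?M ?M shift)" by (intro prob_space.prob_space_distr prob sh)
    fix g :: "_ \<Rightarrow> real" assume g: "continuous_on X g"
    then have gm: "g \<in> borel_measurable (shift_borel d)" by (rule borel_measurable_continuous_on_restrict)
    then have gM: "g \<in> borel_measurable ?M" using sets measurable_cong_sets by blast
    have gs: "(\<lambda>x. g (shift x)) \<in> borel_measurable (shift_borel d)"
      using measurable_compose[OF shift_measurable gm] .
    have "integral\<^sup>L (distr ?M ?M shift) g = integral\<^sup>L ?M (\<lambda>x. g (shift x))"
      by (intro integral_distr sh gM)
    also have "\<dots> = measure_pmf.expectation (map_pmf shift p) g"
      using integral_embed_measure_pmf[OF assms(1) gs] by simp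
    also have "\<dots> = integral\<^sup>L ?M g" using integral_embed_measure_pmf[OF assms(1) gm] assms(2) by simp
    finally show "integral\<^sup>L (distr ?M ?M shift) g = integral\<^sup>L ?M g" .
  qed (use sets prob in auto)
  then show ?thesis using prob sets by (simp add: invariant_probs_def)
qed

section \<open>The maximal mean and its approximation by periodic orbits\<close>

abbreviation m :: real where "m \<equiv> max_mean d f"

lemma f_measurable: "f \<in> borel_measurable (shift_borel d)"
  by (rule borel_measurable_continuous_on_restrict[OF continuous_f])

lemma invariant_probsD:
  assumes "M \<in> invariant_probs d"
  shows "prob_space M" "sets M = sets (shift_borel d)" "space M = X" "distr M M shift = M"
    "shift \<in> M \<rightarrow>\<^sub>M M" "f \<in> borel_measurable M"
proof -
  show 1: "prob_space M" "sets M = sets (shift_borel d)" "distr M M shift = M"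
    using assms by (auto simp: invariant_probs_def)
  show "space M = X" using sets_eq_imp_space_eq[OF 1(2)] space_shift_borel by simp
  show "shift \<in> M \<rightarrow>\<^sub>M M" "f \<in> borel_measurable M"
    using shift_measurable f_measurable 1(2) measurable_cong_sets by blast+
qed

lemma integral_invariant_bounds:
  assumes M: "M \<in> invariant_probs d"
  shows "integral\<^sup>L M (Sf n) = n * integral\<^sup>L M f" "integrable M (Sf n)" "integral\<^sup>L M f \<le> fmax"
proof -
  interpret M: prob_space M by (rule invariant_probsD(1)[OF M])
  note D = invariant_probsD[OF M]
  have sh: "(shift ^^ i) \<in> M \<rightarrow>\<^sub>M M \<and> distr M M (shift ^^ i) = M" for i
  proof (induction i)
    case 0
    then show ?case by (simp add: distr_id2 id_def)
  next
    case (Suc i)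
    then have "distr M M (shift \<circ> (shift ^^ i)) = M"
      using D(5) distr_distr[of shift M M "shift ^^ i" M] D(4) by simp
    moreover have "shift ^^ Suc i = shift \<circ> (shift ^^ i)" by simp
    ultimately show ?case using Suc D(5) measurable_comp[of "shift ^^ i" M M shift M] by metis
  qed
  have bd: "\<bar>f x\<bar> \<le> fmax" if "x \<in> X" for x using f_le[OF that] pos[OF that] by simp
  have int: "integrable M (\<lambda>x. f ((shift ^^ i) x))" for i
    by (rule M.integrable_const_bound[of _ fmax])
       (auto intro!: AE_I2 bd shift_funpow_space measurable_compose[OF _ D(6)] simp: D(3) sh)
  have eq: "integral\<^sup>L M (\<lambda>x. f ((shift ^^ i) x)) = integral\<^sup>L M f" for i
    using integral_distr[of "shift ^^ i" M M f] sh[of i] D(6) by simp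
  show "integrable M (Sf n)" "integral\<^sup>L M (Sf n) = n * integral\<^sup>L M f"
    unfolding birkhoff_sum_def using int by (auto simp: eq)
  show "integral\<^sup>L M f \<le> fmax"
    using int[of 0] by (intro M.integral_le_const) (auto intro!: AE_I2 f_le simp: D(3))
qed

text \<open>The orbit measure of \<open>x\<close> is a competitor in the supremum, with mean
  \<open>Sf n x / n\<close>.\<close>

lemma Sf_fix_le:
  assumes "n \<ge> 1" "x \<in> fix_pts d n"
  shows "Sf n x \<le> n * m"
proof -
  let ?p = "orbit_pmf n x"
  have sp: "set_pmf ?p \<subseteq> X" using assms by (intro set_orbit_pmf fix_pts_space)
  have "embed_measure_pmf ?p \<in> invariant_probs d"
    by (intro embed_measure_pmf_invariant sp map_shift_orbit_pmf[OF assms])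
  then have "integral\<^sup>L (embed_measure_pmf ?p) f \<le> m"
    unfolding max_mean_def using integral_invariant_bounds(3)
    by (intro cSUP_upper bdd_aboveI2[of _ _ fmax]) auto
  moreover have "integral\<^sup>L (embed_measure_pmf ?p) f = Sf n x / n"
    using integral_embed_measure_pmf[OF sp f_measurable] expectation_orbit_pmf[OF assms(1)] by simp
  ultimately show ?thesis using assms(1) by (simp add: field_simps)
qed

lemma Sf_le_mean:
  assumes "x \<in> X"
  shows "Sf n x \<le> n * m + K"
proof (cases "n = 0")
  case True
  then show ?thesis using K_nonneg by (simp add: birkhoff_sum_def)
next
  case False
  then have n: "n \<ge> 1" by simp
  show ?thesis using closing[OF assms n, of 0] Sf_fix_le[OF n, of "repeat_prefix n x"] by simp
qed

text \<open>Otherwise closing up arbitrary points would bound \<open>Sf n\<close> on all of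
  \<open>X\<close> strictly below \<open>n * m\<close>, and integrating would push every invariant
  mean below the supremum.\<close>

lemma exists_fix_near_max:
  assumes n: "n \<ge> 1"
  shows "\<exists>x\<in>fix_pts d n. n * m - K \<le> Sf n x"
proof (rule ccontr)
  assume "\<not> ?thesis"
  then have less: "Sf n x < n * m - K" if "x \<in> fix_pts d n" for x using that by force
  define S where "S = Max (Sf n ` fix_pts d n)"
  have fin: "finite (Sf n ` fix_pts d n)" using finite_fix_pts[OF n] by simp
  have ne: "Sf n ` fix_pts d n \<noteq> {}" using const_fix_pts[OF d_ge] by blast
  have S: "S < n * m - K" using Max_in[OF fin ne] less by (auto simp: S_def)
  have "m \<le> (S + K) / n"
    unfolding max_mean_def
  proof (rule cSUP_least)
    \<comment> \<open>The point mass at a fixed sequence shows that the supremum is over a nonempty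
      set.\<close>
    have "embed_measure_pmf (return_pmf (\<lambda>_. 1)) \<in> invariant_probs d"
      using const_X by (intro embed_measure_pmf_invariant) (auto simp: shift_def)
    then show "invariant_probs d \<noteq> {}" by blast
    fix M assume M: "M \<in> invariant_probs d"
    interpret M: prob_space M by (rule invariant_probsD(1)[OF M])
    have "Sf n x \<le> S + K" if "x \<in> X" for x
    proof -
      note cl = closing[OF that n, of 0]
      have "Sf n (repeat_prefix n x) \<le> S" unfolding S_def using fin cl(1) by (intro Max_ge) auto
      then show ?thesis using cl(3) by simp
    qed
    then have "integral\<^sup>L M (Sf n) \<le> S + K"
      by (intro M.integral_le_const integral_invariant_bounds(2)[OF M] AE_I2)
         (simp add: invariant_probsD(3)[OF M])
    then show "integral\<^sup>L M f \<le> (S + K) / n"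
      using n by (simp add: integral_invariant_bounds(1)[OF M] field_simps)
  qed
  then show False using S n by (simp add: field_simps)
qed

lemma small_distortion:
  assumes "e > 0"
  shows "\<exists>q. K * \<theta> ^ q < e"
proof -
  have "(\<lambda>q. K * \<theta> ^ q) \<longlonglongrightarrow> K * 0"
    using theta_pos theta_less by (intro tendsto_intros LIMSEQ_realpow_zero) auto
  then have "\<forall>\<^sub>F q in sequentially. K * \<theta> ^ q < e" using assms by (simp add: order_tendsto_iff)
  then show ?thesis by (auto simp: eventually_sequentially)
qed

text \<open>Along an almost maximizing orbit the defects \<open>i m - f\<^sup>i(x)\<close> stay bounded, so by pigeonhole two of them
  nearly agree at times with the same prefix; closing up the orbit between these times proves the claim.\<close>

lemma exists_fix_small_defect:
  assumes e: "e > 0"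
  shows "\<exists>n\<ge>1. \<exists>y\<in>fix_pts d n. n * m - Sf n y \<le> e"
proof -
  obtain q where q: "K * \<theta> ^ q < e / 2" using small_distortion[of "e / 2"] e by auto
  \<comment> \<open>The pigeonholes: a prefix of length \<open>q\<close> together with the defect,
    known to lie between \<open>- K\<close> and \<open>2 * K\<close>, rounded in units of
    \<open>e / 2\<close>.\<close>
  define W where "W = {xs. set xs \<subseteq> {1..d} \<and> length xs = q} \<times> {\<lfloor>- K / (e / 2)\<rfloor>..\<lfloor>2 * K / (e / 2)\<rfloor>}"
  have finW: "finite W" unfolding W_def by (intro finite_cartesian_product finite_words) auto
  define N where "N = Suc (card W)"
  obtain x where x: "x \<in> fix_pts d N" "N * m - K \<le> Sf N x"
    using exists_fix_near_max[of N] by (auto simp: N_def)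
  define b where "b i = i * m - Sf i x" for i :: nat
  have xX: "x \<in> X" using x fix_pts_space by blast
  have b_lower: "- K \<le> b i" for i using Sf_le_mean[OF xX, of i] by (simp add: b_def)
  \<comment> \<open>The rest of the orbit can exceed its mean by at most \<open>K\<close>, so a
    larger defect at time \<open>i\<close> could not be recovered by time \<open>N\<close>.\<close>
  have b_upper: "b i \<le> 2 * K" if "i \<le> N" for i
  proof -
    have "Sf N x = Sf i x + Sf (N - i) ((shift ^^ i) x)"
      using birkhoff_sum_add[of i "N - i" f x] that by simp
    moreover have "Sf (N - i) ((shift ^^ i) x) \<le> (N - i) * m + K"
      by (rule Sf_le_mean[OF shift_funpow_space[OF xX]])
    ultimately show ?thesis using x(2) that by (simp add: b_def of_nat_diff algebra_simps)
  qed
  define \<phi> where "\<phi> i = (map ((shift ^^ i) x) [0..<q], \<lfloor>b i / (e / 2)\<rfloor>)" for i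
  have "\<phi> ` {..N} \<subseteq> W"
  proof
    fix z assume "z \<in> \<phi> ` {..N}"
    then obtain i where i: "i \<le> N" "z = \<phi> i" by auto
    have "\<lfloor>- K / (e / 2)\<rfloor> \<le> \<lfloor>b i / (e / 2)\<rfloor>" "\<lfloor>b i / (e / 2)\<rfloor> \<le> \<lfloor>2 * K / (e / 2)\<rfloor>"
      using b_lower[of i] b_upper[OF i(1)] e by (intro floor_mono divide_right_mono; simp)+
    then show "z \<in> W"
      using prefix_words[OF shift_funpow_space[OF xX], of i q] by (simp add: i(2) \<phi>_def W_def)
  qed
  then have "\<not> inj_on \<phi> {..N}"
    using card_inj_on_le[of \<phi> "{..N}" W] finW by (auto simp: N_def)
  then obtain i j where ij: "i < j" "\<phi> i = \<phi> j"
    unfolding inj_on_def by (metis linorder_neqE_nat)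
  define n where "n = j - i"
  let ?z = "(shift ^^ i) x"
  have n: "n \<ge> 1" and j: "j = i + n" using ij by (auto simp: n_def)
  have zX: "?z \<in> X" by (rule shift_funpow_space[OF xX])
  have "map ?z [0..<q] = map ((shift ^^ j) x) [0..<q]" using ij(2) by (simp add: \<phi>_def del: map_eq_conv)
  then have rep: "?z (n + t) = ?z t" if "t < q" for t
    using that unfolding prefix_eq_iff by (simp add: shift_funpow j add.assoc)
  have "\<lfloor>b i / (e / 2)\<rfloor> = \<lfloor>b j / (e / 2)\<rfloor>" using ij(2) by (simp add: \<phi>_def)
  then have "b j / (e / 2) - b i / (e / 2) \<le> 1" by linarith
  then have "b j - b i \<le> e / 2" using e by (simp add: field_simps)
  moreover have "Sf n ?z = n * m - (b j - b i)"
    using birkhoff_sum_add[of i n f x] by (simp add: b_def j algebra_simps)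
  ultimately have S: "n * m - Sf n ?z \<le> e / 2" by simp
  \<comment> \<open>Half of \<open>e\<close> was spent on the rounding; closing up costs less than
    the other half.\<close>
  have "\<bar>Sf n (repeat_prefix n ?z) - Sf n ?z\<bar> \<le> K * \<theta> ^ q"
    by (rule closing(3)[OF zX n]) (rule rep)
  then have "n * m - Sf n (repeat_prefix n ?z) \<le> e" using S q by linarith
  moreover have "repeat_prefix n ?z \<in> fix_pts d n" by (rule repeat_prefix_fix_pts[OF zX])
  ultimately show ?thesis using n by blast
qed

lemma per_rate_nonneg: "y \<in> per_pts d \<Longrightarrow> 0 \<le> per_rate d f y"
  using min_period_fix_pts(1,2) Sf_fix_le by (fastforce simp: per_pts_def per_rate_def)

text \<open>The defect over \<open>k\<close> minimal periods is \<open>k\<close> times the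
  nonnegative rate. This lets the rate control the terms of every period in the series.\<close>

lemma per_rate_le_defect:
  assumes "n \<ge> 1" "y \<in> fix_pts d n"
  shows "per_rate d f y \<le> n * m - Sf n y"
proof -
  obtain k where k: "k \<ge> 1" "n = k * min_period y" using min_period_fix_pts(3)[OF assms(2,1)] by blast
  have "y \<in> per_pts d" using assms by (auto simp: per_pts_def)
  then have "1 * per_rate d f y \<le> k * per_rate d f y"
    using k per_rate_nonneg by (intro mult_right_mono) auto
  also have "\<dots> = n * m - Sf n y"
    using birkhoff_sum_mult[of "min_period y" y k f] min_period_fix_pts(2)[OF assms(2,1)] k(2)
    by (simp add: fix_pts_def per_rate_def algebra_simps)
  finally show ?thesis by simp
qed

end

section \<open>Pressure and the zeta sums\<close>

lemma tendsto_add_const_over: "(\<lambda>n. a + b / real n) \<longlonglongrightarrow> (a :: real)"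
  using tendsto_add[OF tendsto_const lim_const_over_n] by simp

lemma ln_le_of_le_exp: "0 < x \<Longrightarrow> x \<le> exp y \<Longrightarrow> ln x \<le> (y :: real)"
  using ln_le_cancel_iff[of x "exp y"] by simp

context positive_lipschitz_potential
begin

lemma birkhoff_sum_scale: "birkhoff_sum shift n (\<lambda>y. c * f y) x = c * Sf n x"
  by (simp add: birkhoff_sum_def sum_distrib_left)

text \<open>Shifting by the first place where two such points differ moves the difference to
  coordinate 0, where the distance is \<open>\<theta>\<close>.\<close>

lemma fix_pts_separated:
  assumes "n \<ge> 1" "\<epsilon> < \<theta>"
  shows "separated_set X (shift_dist \<theta>) shift n \<epsilon> (fix_pts d n)"
  unfolding separated_set_def
proof (intro conjI ballI impI)
  fix x y assume xy: "x \<in> fix_pts d n" "y \<in> fix_pts d n" "x \<noteq> y"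
  then obtain i where i: "i < n" "x i \<noteq> y i" using fix_pts_eqI assms(1) by blast
  let ?u = "(shift ^^ i) x" and ?v = "(shift ^^ i) y"
  have uv: "?u 0 \<noteq> ?v 0" using i by (simp add: shift_funpow)
  then have "shift_dist \<theta> ?u ?v = \<theta>"
    unfolding shift_dist_def by (subst Least_eq_0) auto
  then show "\<exists>i<n. \<epsilon> < shift_dist \<theta> ((shift ^^ i) x) ((shift ^^ i) y)"
    using i(1) assms(2) by auto
qed (use finite_fix_pts assms fix_pts_space in auto)

text \<open>Separated points already differ within the first \<open>n + p\<close> coordinates, so
  periodizing these is injective. It costs \<open>K\<close>, and the \<open>p\<close> additional
  summands only help because \<open>f\<close> is positive.\<close>

lemma separated_sum_le_periodic_sum:
  assumes E: "separated_set X (shift_dist \<theta>) shift n \<epsilon> E" and n: "n \<ge> 1" and c: "c \<ge> 0"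
    and p: "\<theta> ^ Suc p \<le> \<epsilon>"
  shows "(\<Sum>x\<in>E. exp (c * Sf n x)) \<le> exp (c * K) * periodic_sum c (n + p) UNIV"
proof -
  let ?r = "repeat_prefix (n + p) :: _ \<Rightarrow> nat \<Rightarrow> nat"
  have np: "n + p \<ge> 1" using n by simp
  have E': "finite E" "E \<subseteq> X" using E by (auto simp: separated_set_def)
  have r: "\<And>x i. i < n + p \<Longrightarrow> ?r x i = x i" by (simp add: repeat_prefix_def)
  have inj: "inj_on ?r E"
  proof (rule inj_onI, rule ccontr)
    fix x y assume xy: "x \<in> E" "y \<in> E" "?r x = ?r y" "x \<noteq> y"
    then obtain i where i: "i < n" "shift_dist \<theta> ((shift ^^ i) x) ((shift ^^ i) y) > \<epsilon>"
      using E unfolding separated_set_def by blast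
    have "x j = y j" if "j < n + p" for j using r[OF that, of x] r[OF that, of y] xy(3) by simp
    then have "shift_dist \<theta> ((shift ^^ i) x) ((shift ^^ i) y) \<le> \<theta> ^ Suc p"
      using i(1) by (subst shift_dist_le_iff[OF theta_pos theta_less]) (simp add: shift_funpow)
    then show False using i(2) p by simp
  qed
  have "(\<Sum>x\<in>E. exp (c * Sf n x)) \<le> (\<Sum>x\<in>E. exp (c * K) * exp (c * Sf (n + p) (?r x)))"
  proof (rule sum_mono)
    fix x assume "x \<in> E"
    then have x: "x \<in> X" using E' by auto
    have rx: "?r x \<in> X" using repeat_prefix_fix_pts[OF x] fix_pts_space by blast
    have "\<bar>Sf n x - Sf n (?r x)\<bar> \<le> K * \<theta> ^ 0"
      using r by (intro distortion x rx) auto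
    moreover have "Sf n (?r x) \<le> Sf (n + p) (?r x)"
      using Sf_nonneg[OF shift_funpow_space[OF rx]] by (simp add: birkhoff_sum_add)
    ultimately have "Sf n x \<le> K + Sf (n + p) (?r x)" by simp
    from mult_left_mono[OF this c]
    show "exp (c * Sf n x) \<le> exp (c * K) * exp (c * Sf (n + p) (?r x))"
      by (simp add: exp_add[symmetric] algebra_simps)
  qed
  also have "\<dots> = exp (c * K) * (\<Sum>z\<in>?r ` E. exp (c * Sf (n + p) z))"
    by (simp add: sum_distrib_left sum.reindex[OF inj])
  also have "\<dots> \<le> exp (c * K) * periodic_sum c (n + p) UNIV"
    unfolding periodic_sum_def using E' repeat_prefix_fix_pts finite_fix_pts[OF np]
    by (intro mult_left_mono sum_mono2) auto
  finally show ?thesis .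
qed

text \<open>For \<open>\<epsilon> < \<theta>\<close> the separated sums lie between the periodic
  sums of lengths \<open>n\<close> and \<open>n + p\<close>, up to a factor independent of
  \<open>n\<close>. The limsup is thus constant for small \<open>\<epsilon>\<close>.\<close>

lemma pressure_eq_P:
  assumes c: "c \<ge> 0"
  shows "pressure d \<theta> (\<lambda>y. c * f y) = P c"
proof -
  let ?S = "\<lambda>\<epsilon> n. separated_sum X (shift_dist \<theta>) shift (\<lambda>y. c * f y) n \<epsilon>"
  have lim: "limsup (\<lambda>n. ereal (ln (?S \<epsilon> n) / n)) = ereal (P c)" if \<epsilon>: "0 < \<epsilon>" "\<epsilon> < \<theta>" for \<epsilon>
  proof -
    have "(\<lambda>p. \<theta> ^ Suc p) \<longlonglongrightarrow> 0"
      using theta_pos theta_less by (intro LIMSEQ_Suc LIMSEQ_realpow_zero) auto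
    then have "\<forall>\<^sub>F p in sequentially. \<theta> ^ Suc p < \<epsilon>" using \<epsilon> by (simp add: order_tendsto_iff)
    then obtain p where "\<theta> ^ Suc p < \<epsilon>" by (auto simp: eventually_sequentially)
    then have p: "\<theta> ^ Suc p \<le> \<epsilon>" by simp
    have upper: "?S \<epsilon> n \<le> exp (c * K) * periodic_sum c (n + p) UNIV" if "n \<ge> 1" for n
      unfolding separated_sum_def birkhoff_sum_scale
      using separated_sum_le_periodic_sum[OF _ that c p] fix_pts_separated[OF that \<epsilon>(2)]
      by (intro cSUP_least) auto
    have lower: "periodic_sum c n UNIV \<le> ?S \<epsilon> n" if "n \<ge> 1" for n
      unfolding separated_sum_def birkhoff_sum_scale periodic_sum_def Int_UNIV_right
      using fix_pts_separated[OF that \<epsilon>(2)] separated_sum_le_periodic_sum[OF _ that c p]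
      by (intro cSUP_upper bdd_aboveI2) auto
    have pos: "?S \<epsilon> n > 0" if "n \<ge> 1" for n
      using lower[OF that] periodic_sum_ge_1[OF c that] by simp
    \<comment> \<open>One \<open>c * K\<close> comes from periodizing and two from
      \<open>periodic_sum_upper\<close> with \<open>q = 0\<close>; all vanish after division by
      \<open>n\<close>.\<close>
    have "ln (?S \<epsilon> n) \<le> 3 * c * K + (n + p) * P c" if "n \<ge> 1" for n
    proof -
      have "?S \<epsilon> n \<le> exp (c * K) * exp (2 * c * K + (n + p) * P c)"
        using periodic_sum_upper[OF c, of "n + p" 0] that
        by (intro order_trans[OF upper[OF that]] mult_left_mono) auto
      also have "\<dots> = exp (3 * c * K + (n + p) * P c)" by (simp add: exp_add[symmetric])
      finally show ?thesis by (rule ln_le_of_le_exp[OF pos[OF that]])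
    qed
    then have "\<forall>\<^sub>F n in sequentially. ereal (ln (?S \<epsilon> n) / n) \<le> ereal ((3 * c * K + (n + p) * P c) / n)"
      by (auto simp: eventually_sequentially intro!: exI[of _ 1] divide_right_mono)
    then have "limsup (\<lambda>n. ereal (ln (?S \<epsilon> n) / n)) \<le> limsup (\<lambda>n. ereal ((3 * c * K + (n + p) * P c) / n))"
      by (rule Limsup_mono)
    also have "\<dots> = limsup (\<lambda>n. ereal (P c + (3 * c * K + p * P c) / n))"
      by (rule Limsup_eq) (auto simp: eventually_sequentially field_simps intro!: exI[of _ 1])
    also have "\<dots> = ereal (P c)"
      by (intro lim_imp_Limsup tendsto_ereal tendsto_add_const_over) auto
    finally have "limsup (\<lambda>n. ereal (ln (?S \<epsilon> n) / n)) \<le> ereal (P c)" .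
    moreover have "ereal (P c) \<le> limsup (\<lambda>n. ereal (ln (?S \<epsilon> n) / n))"
      unfolding limsup_lnZ_rate[OF c, symmetric] lnZ_rate_def
    proof (rule Limsup_mono, unfold eventually_sequentially, intro exI[of _ 1] allI impI)
      fix n :: nat assume n: "1 \<le> n"
      have "ln (periodic_sum c n UNIV) \<le> ln (?S \<epsilon> n)"
        using lower[OF n] periodic_sum_ge_1[OF c n] by (subst ln_le_cancel_iff) auto
      then show "ereal (ln (periodic_sum c n UNIV) / n) \<le> ereal (ln (?S \<epsilon> n) / n)"
        by (simp add: divide_right_mono)
    qed
    ultimately show ?thesis by (rule antisym)
  qed
  have "\<forall>\<^sub>F \<epsilon> in at_right 0. limsup (\<lambda>n. ereal (ln (?S \<epsilon> n) / n)) = ereal (P c)"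
    using eventually_at_right_real[OF theta_pos] by eventually_elim (simp add: lim)
  then have "((\<lambda>\<epsilon>. limsup (\<lambda>n. ereal (ln (?S \<epsilon> n) / n))) \<longlongrightarrow> ereal (P c)) (at_right 0)"
    by (rule tendsto_eventually)
  then show ?thesis
    unfolding pressure_def topological_pressure_def by (subst tendsto_Lim) auto
qed

section \<open>Pressure of the normalized potential \<open>c * (f - m)\<close>\<close>

definition excess_pressure :: "real \<Rightarrow> real" where "excess_pressure c = P c - c * m"

text \<open>A single almost maximizing point in each period already gives the growth rate
  \<open>c * m\<close>.\<close>

lemma excess_pressure_nonneg:
  assumes c: "c \<ge> 0"
  shows "0 \<le> excess_pressure c"
proof -
  have "c * m \<le> P c"
  proof (rule P_ge_bound[OF c, where n = 1 and g = "\<lambda>k. c * m - c * K / real k"])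
    fix k :: nat assume k: "k \<ge> 1"
    obtain x where x: "x \<in> fix_pts d k" "k * m - K \<le> Sf k x" using exists_fix_near_max[OF k] by blast
    have "exp (c * Sf k x) \<le> periodic_sum c k UNIV"
      unfolding periodic_sum_def using x(1) finite_fix_pts[OF k] by (intro member_le_sum) auto
    then have "c * Sf k x \<le> ln (periodic_sum c k UNIV)"
      using periodic_sum_ge_1[OF c k] by (subst ln_ge_iff) auto
    then have "c * (k * m - K) \<le> ln (periodic_sum c k UNIV)"
      using mult_left_mono[OF x(2) c] by linarith
    then have "c * (k * m - K) / k \<le> lnZ_rate c k" unfolding lnZ_rate_def by (rule divide_right_mono) simp
    then show "c * m - c * K / k \<le> lnZ_rate c (1 * k)" using k by (simp add: field_simps)
  next
    show "(\<lambda>k. c * m - c * K / real k) \<longlonglongrightarrow> c * m"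
      using tendsto_add_const_over[of "c * m" "- c * K"] by simp
  qed simp
  then show ?thesis by (simp add: excess_pressure_def)
qed

text \<open>By \<open>Sf_fix_le\<close>, passing from \<open>c\<close> to \<open>c'\<close>
  multiplies each term by at most \<open>exp ((c' - c) * (n * m))\<close>.\<close>

lemma excess_pressure_antimono:
  assumes c: "0 \<le> c" "c \<le> c'"
  shows "excess_pressure c' \<le> excess_pressure c"
proof -
  have "P c' \<le> (c' - c) * m + P c"
  proof (rule P_le_bound[where g = "\<lambda>n. (c' - c) * m + P c + 2 * c * K / real n"])
    fix n :: nat assume n: "n \<ge> 1"
    have "periodic_sum c' n UNIV \<le> (\<Sum>x\<in>fix_pts d n \<inter> UNIV. exp ((c' - c) * (n * m)) * exp (c * Sf n x))"
      unfolding periodic_sum_def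
    proof (rule sum_mono)
      fix x assume "x \<in> fix_pts d n \<inter> UNIV"
      then have "(c' - c) * Sf n x \<le> (c' - c) * (n * m)"
        using Sf_fix_le[OF n] c by (intro mult_left_mono) auto
      then show "exp (c' * Sf n x) \<le> exp ((c' - c) * (n * m)) * exp (c * Sf n x)"
        by (simp add: exp_add[symmetric] algebra_simps)
    qed
    also have "\<dots> = exp ((c' - c) * (n * m)) * periodic_sum c n UNIV"
      by (simp add: periodic_sum_def sum_distrib_left)
    also have "\<dots> \<le> exp ((c' - c) * (n * m)) * exp (2 * c * K + n * P c)"
      using periodic_sum_upper[OF c(1) n, of 0] by (intro mult_left_mono) auto
    also have "\<dots> = exp ((c' - c) * (n * m) + (2 * c * K + n * P c))" by (simp only: exp_add)
    finally have "ln (periodic_sum c' n UNIV) \<le> (c' - c) * (n * m) + (2 * c * K + n * P c)"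
      using periodic_sum_ge_1[of c' n] c n by (intro ln_le_of_le_exp) auto
    then have "lnZ_rate c' n \<le> ((c' - c) * (n * m) + (2 * c * K + n * P c)) / n"
      unfolding lnZ_rate_def by (rule divide_right_mono) simp
    then show "lnZ_rate c' n \<le> (c' - c) * m + P c + 2 * c * K / n"
      using n by (simp add: add_divide_distrib)
  next
    show "(\<lambda>n. (c' - c) * m + P c + 2 * c * K / real n) \<longlonglongrightarrow> (c' - c) * m + P c" by (rule tendsto_add_const_over)
  qed (use c in auto)
  then show ?thesis by (simp add: excess_pressure_def algebra_simps)
qed

text \<open>A nonincreasing function bounded below comes within \<open>\<delta>\<close> of its
  infimum and stays there, so its values at \<open>\<eta> * c\<close> and \<open>c\<close> differ
  little once both arguments are large.\<close>

lemma excess_pressure_stable: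
  assumes "\<delta> > 0" "\<eta> > 0"
  shows "\<exists>c0>0. \<forall>c\<ge>c0. excess_pressure (\<eta> * c) \<le> excess_pressure c + \<delta>"
proof -
  define l where "l = (INF c\<in>{0..}. excess_pressure c)"
  have bdd: "bdd_below (excess_pressure ` {0..})" using excess_pressure_nonneg by (intro bdd_belowI2[of _ 0]) auto
  have "l < l + \<delta>" using assms by simp
  then obtain c1 where c1: "c1 \<ge> 0" "excess_pressure c1 < l + \<delta>"
    using cINF_less_iff[OF _ bdd, of "l + \<delta>"] by (auto simp: l_def)
  have "excess_pressure (\<eta> * c) \<le> excess_pressure c + \<delta>" if "c \<ge> (c1 + 1) / \<eta>" for c
  proof -
    have "c1 \<le> \<eta> * c" using that assms by (simp add: field_simps)
    then have "excess_pressure (\<eta> * c) \<le> excess_pressure c1" using c1 by (intro excess_pressure_antimono) auto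
    moreover have "0 \<le> (c1 + 1) / \<eta>" using c1 assms by simp
    then have "l \<le> excess_pressure c" unfolding l_def using bdd that by (intro cINF_lower) auto
    ultimately show ?thesis using c1 by simp
  qed
  moreover have "(c1 + 1) / \<eta> > 0" using c1 assms by simp
  ultimately show ?thesis by blast
qed

section \<open>The series over periodic points and their exponential rate\<close>

definition zeta_term :: "real \<Rightarrow> real \<Rightarrow> (nat \<Rightarrow> nat) set \<Rightarrow> nat \<Rightarrow> real" where
  "zeta_term c s A n = (\<Sum>x\<in>fix_pts d n \<inter> A. exp (c * s * Sf n x - n * P c))"

definition zeta_sum :: "real \<Rightarrow> real \<Rightarrow> (nat \<Rightarrow> nat) set \<Rightarrow> real" where
  "zeta_sum c s A = (\<Sum>n. zeta_term c s A (Suc n))"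

text \<open>A fraction \<open>1 - \<eta>\<close> of the energy is bounded pointwise through \<open>J\<close>, the remaining fraction \<open>\<eta>\<close> through
  the pressure at \<open>\<eta> c\<close>; the prefix length \<open>q\<close> makes the exponential cost of the distortion small.\<close>

lemma zeta_term_upper:
  assumes c: "c > 0" and s: "0 < s" "s < 1" and \<eta>: "0 \<le> \<eta>" "\<eta> \<le> 1" and n: "n \<ge> 1"
    and J: "\<And>x. x \<in> fix_pts d n \<inter> A \<Longrightarrow> J \<le> n * m - Sf n x"
    and \<delta>: "excess_pressure (\<eta> * c) \<le> excess_pressure c + \<delta>"
  shows "zeta_term c s A n \<le>
    real d ^ q * exp (2 * \<eta> * c * K * \<theta> ^ q - (1 - \<eta>) * c * J) * exp (\<delta> - c * (1 - s) * fmin) ^ n"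
proof -
  let ?B = "(1 - \<eta>) * c * (n * m - J) - c * (1 - s) * (n * fmin) - n * P c"
  have "zeta_term c s A n \<le> (\<Sum>x\<in>fix_pts d n \<inter> A. exp ?B * exp (\<eta> * c * Sf n x))"
    unfolding zeta_term_def
  proof (rule sum_mono)
    fix x assume x: "x \<in> fix_pts d n \<inter> A"
    have 1: "(1 - \<eta>) * c * Sf n x \<le> (1 - \<eta>) * c * (n * m - J)"
      using J[OF x] c \<eta> by (intro mult_left_mono) auto
    have 2: "c * (1 - s) * (n * fmin) \<le> c * (1 - s) * Sf n x"
      using x c s by (intro mult_left_mono Sf_ge) (auto dest: fix_pts_space)
    have "c * s * Sf n x = (1 - \<eta>) * c * Sf n x - c * (1 - s) * Sf n x + \<eta> * c * Sf n x"
      by (simp add: algebra_simps)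
    then have "c * s * Sf n x - n * P c \<le> ?B + \<eta> * c * Sf n x" using 1 2 by linarith
    then show "exp (c * s * Sf n x - n * P c) \<le> exp ?B * exp (\<eta> * c * Sf n x)"
      by (simp add: exp_add[symmetric])
  qed
  also have "\<dots> \<le> exp ?B * periodic_sum (\<eta> * c) n UNIV"
    unfolding periodic_sum_def sum_distrib_left
    using finite_fix_pts[OF n] by (intro sum_mono2) auto
  also have "\<dots> \<le> exp ?B * (real d ^ q * exp (2 * (\<eta> * c) * K * \<theta> ^ q + n * P (\<eta> * c)))"
    using c \<eta> n by (intro mult_left_mono periodic_sum_upper) auto
  also have "\<dots> = real d ^ q * exp (?B + (2 * (\<eta> * c) * K * \<theta> ^ q + n * P (\<eta> * c)))"
    by (simp add: exp_add)
  also have "\<dots> \<le> real d ^ q * exp ((2 * \<eta> * c * K * \<theta> ^ q - (1 - \<eta>) * c * J) + n * (\<delta> - c * (1 - s) * fmin))"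
  proof -
    \<comment> \<open>The multiples of \<open>m\<close> combine with both pressures into a
      difference of excess pressures, which costs at most \<open>\<delta>\<close> per unit of
      \<open>n\<close>.\<close>
    have "n * (P (\<eta> * c) - \<eta> * c * m) \<le> n * (P c - c * m + \<delta>)"
      using \<delta> by (intro mult_left_mono) (auto simp: excess_pressure_def)
    then show ?thesis by (intro mult_left_mono) (auto simp: algebra_simps)
  qed
  finally show ?thesis by (simp add: exp_add exp_of_nat_mult)
qed

lemma zeta_term_nonneg: "0 \<le> zeta_term c s A n"
  by (auto simp: zeta_term_def intro: sum_nonneg)

text \<open>The instance \<open>\<eta> = 1\<close>, \<open>\<delta> = 0\<close>,
  \<open>q = 0\<close> of \<open>zeta_term_upper\<close>: \<open>J\<close> drops out and the
  geometric ratio is below 1 because \<open>s < 1\<close> and \<open>fmin > 0\<close>.\<close>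

lemma zeta_term_summable:
  assumes "c > 0" "0 < s" "s < 1"
  shows "summable (\<lambda>n. zeta_term c s A (Suc n))"
proof -
  let ?r = "exp (0 - c * (1 - s) * fmin)"
  have "?r < 1" using assms fmin_pos by simp
  then have sm: "summable (\<lambda>n. exp (2 * c * K) * ?r ^ Suc n)"
    by (intro summable_mult summable_ignore_initial_segment[of _ 1, simplified] summable_geometric) auto
  have "zeta_term c s A (Suc n) \<le> exp (2 * c * K) * ?r ^ Suc n" for n
  proof -
    have "0 \<le> real (Suc n) * m - Sf (Suc n) x" if "x \<in> fix_pts d (Suc n) \<inter> A" for x
      using Sf_fix_le[of "Suc n" x] that by (simp del: of_nat_Suc)
    from zeta_term_upper[OF assms, of 1 "Suc n" A 0 0 0, OF _ _ _ this]
    show ?thesis by (simp del: of_nat_Suc power_Suc)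
  qed
  then have le: "norm (zeta_term c s A (Suc n)) \<le> exp (2 * c * K) * ?r ^ Suc n" for n
    by (simp only: real_norm_def abs_of_nonneg[OF zeta_term_nonneg])
  show ?thesis by (rule summable_comparison_test'[OF sm, where N = 0]) (rule le)
qed

lemma zeta_sum_lower:
  assumes "c > 0" "0 < s" "s < 1" "n \<ge> 1" "x \<in> fix_pts d n \<inter> A"
  shows "exp (c * s * Sf n x - n * P c) \<le> zeta_sum c s A"
proof -
  have "exp (c * s * Sf n x - n * P c) \<le> zeta_term c s A n"
    unfolding zeta_term_def using assms finite_fix_pts[of n d] by (intro member_le_sum) auto
  also have "\<dots> = (\<Sum>k\<in>{n - 1}. zeta_term c s A (Suc k))" using assms(4) by simp
  also have "\<dots> \<le> zeta_sum c s A"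
    unfolding zeta_sum_def
    by (intro sum_le_suminf zeta_term_summable assms(1-3)) (auto simp: zeta_term_nonneg)
  finally show ?thesis .
qed

text \<open>Here \<open>J\<close> is the infimum of the defects over \<open>A\<close>. The set is
  kept general to cover a cylinder and, with \<open>J = 0\<close>, the normalizing series; the
  eventual bound \<open>ell\<close> is common to both regimes of \<open>c (1 - s)\<close>.\<close>

context
  fixes c s :: "nat \<Rightarrow> real" and ell J :: real and A :: "(nat \<Rightarrow> nat) set"
  assumes c_pos: "\<And>j. c j > 0" and s_pos: "\<And>j. 0 < s j" and s_less: "\<And>j. s j < 1"
    and c_top: "filterlim c at_top sequentially" and s_lim: "s \<longlonglongrightarrow> 1"
    and ell: "ell > 0" "\<forall>\<^sub>F j in sequentially. ell \<le> c j * (1 - s j)"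
    and J_lower: "\<And>n x. n \<ge> 1 \<Longrightarrow> x \<in> fix_pts d n \<inter> A \<Longrightarrow> J \<le> n * m - Sf n x"
    and J_upper: "\<And>e. e > 0 \<Longrightarrow> \<exists>n\<ge>1. \<exists>x\<in>fix_pts d n \<inter> A. n * m - Sf n x \<le> J + e"
    and J_nonneg: "J \<ge> 0"
begin

lemma zeta_sum_eventually_le:
  assumes e: "e > 0"
  shows "\<forall>\<^sub>F j in sequentially. zeta_sum (c j) (s j) A \<le> exp (c j * (- J + e))"
proof -
  \<comment> \<open>Chosen so that \<open>\<eta> * J \<le> e / 3\<close>; \<open>J + 1\<close>
    avoids a division by zero.\<close>
  define \<eta> where "\<eta> = min (1 / 2) (e / (3 * (J + 1)))"
  have \<eta>: "0 < \<eta>" "\<eta> \<le> 1" using e J_nonneg by (auto simp: \<eta>_def)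
  have "\<eta> * (J + 1) \<le> e / (3 * (J + 1)) * (J + 1)"
    using J_nonneg by (intro mult_right_mono) (auto simp: \<eta>_def)
  also have "\<dots> = e / 3" using J_nonneg by (simp add: field_simps)
  finally have \<eta>J: "\<eta> * J \<le> e / 3" using \<eta> by (simp add: algebra_simps)
  obtain q where q: "K * \<theta> ^ q < e / 6" using small_distortion[of "e / 6"] e by auto
  \<comment> \<open>Half of the guaranteed decay rate \<open>ell * fmin\<close> pays for the change
    of pressure; the other half is left in the ratio \<open>r\<close>.\<close>
  define \<delta> where "\<delta> = ell * fmin / 2"
  have \<delta>: "\<delta> > 0" using ell fmin_pos by (simp add: \<delta>_def)
  obtain c0 where c0: "\<And>c. c \<ge> c0 \<Longrightarrow> excess_pressure (\<eta> * c) \<le> excess_pressure c + \<delta>" using excess_pressure_stable[OF \<delta> \<eta>(1)] by blast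
  define r where "r = exp (- \<delta>)"
  have r: "0 \<le> r" "r < 1" using \<delta> by (auto simp: r_def)
  \<comment> \<open>Collects the factors independent of \<open>j\<close>. The margin
    \<open>e\<close> is spent in thirds: on \<open>\<eta> * J\<close>, on the distortion, and on
    \<open>G\<close> once \<open>c j\<close> is large.\<close>
  define G where "G = real d ^ q * (r / (1 - r))"
  have "\<forall>\<^sub>F j in sequentially. c0 \<le> c j" using c_top by (simp add: filterlim_at_top)
  moreover have "\<forall>\<^sub>F j in sequentially. ln (max G 1) / (e / 3) \<le> c j"
    using c_top by (simp add: filterlim_at_top)
  ultimately show ?thesis using ell(2)
  proof eventually_elim
    case (elim j)
    let ?c = "c j" and ?s = "s j"
    let ?E = "real d ^ q * exp (?c * (- J + 2 * e / 3))"
    have bound: "zeta_term ?c ?s A (Suc n) \<le> ?E * r * r ^ n" for n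
    proof -
      have "zeta_term ?c ?s A (Suc n) \<le>
          real d ^ q * exp (2 * \<eta> * ?c * K * \<theta> ^ q - (1 - \<eta>) * ?c * J) * exp (\<delta> - ?c * (1 - ?s) * fmin) ^ Suc n"
        using \<eta> c0[OF elim(1)] J_lower[of "Suc n"]
        by (intro zeta_term_upper c_pos s_pos s_less) auto
      also have "\<dots> \<le> ?E * r ^ Suc n"
      proof (intro mult_mono power_mono)
        have "\<eta> * (K * \<theta> ^ q) \<le> 1 * (e / 6)"
          using \<eta> q K_nonneg theta_pos by (intro mult_mono) auto
        then have "2 * \<eta> * K * \<theta> ^ q - (1 - \<eta>) * J \<le> - J + 2 * e / 3"
          using \<eta>J by (simp add: algebra_simps)
        from mult_left_mono[OF this less_imp_le[OF c_pos[of j]]]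
        show "exp (2 * \<eta> * ?c * K * \<theta> ^ q - (1 - \<eta>) * ?c * J) \<le> exp (?c * (- J + 2 * e / 3))"
          by (simp add: algebra_simps)
        have "ell * fmin \<le> ?c * (1 - ?s) * fmin" using elim(3) fmin_pos by (intro mult_right_mono) auto
        then show "exp (\<delta> - ?c * (1 - ?s) * fmin) \<le> r" by (simp add: r_def \<delta>_def)
      qed (use r in auto)
      finally show ?thesis by simp
    qed
    have "zeta_sum ?c ?s A \<le> (\<Sum>n. ?E * r * r ^ n)"
      unfolding zeta_sum_def using r
      by (intro suminf_le bound zeta_term_summable c_pos s_pos s_less summable_mult summable_geometric) auto
    also have "\<dots> = ?E * r * (1 / (1 - r))"
      using r by (subst suminf_mult) (auto simp: suminf_geometric summable_geometric)
    also have "\<dots> = exp (?c * (- J + 2 * e / 3)) * G" by (simp add: G_def)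
    also have "\<dots> \<le> exp (?c * (- J + 2 * e / 3)) * exp (?c * (e / 3))"
    proof (rule mult_left_mono)
      have "ln (max G 1) \<le> ?c * (e / 3)" using elim(2) e by (simp add: field_simps)
      then have "max G 1 \<le> exp (?c * (e / 3))" using ln_le_cancel_iff[of "max G 1" "exp (?c * (e / 3))"] by simp
      then show "G \<le> exp (?c * (e / 3))" by simp
    qed simp
    also have "\<dots> = exp (?c * (- J + e))" by (simp add: exp_add[symmetric] algebra_simps)
    finally show ?case .
  qed
qed

lemma zeta_sum_eventually_ge:
  assumes e: "e > 0"
  shows "\<forall>\<^sub>F j in sequentially. exp (c j * (- J - e)) \<le> zeta_sum (c j) (s j) A"
proof -
  obtain n x where n: "n \<ge> 1" and x: "x \<in> fix_pts d n \<inter> A" and nx: "n * m - Sf n x \<le> J + e / 2"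
    using J_upper[of "e / 2"] e by auto
  \<comment> \<open>With \<open>n\<close> and \<open>x\<close> fixed, both corrections vanish
    relative to \<open>c j\<close>: one since \<open>s\<close> tends to 1, the other since the
    excess pressure is at most its value at 1 once \<open>c j \<ge> 1\<close>.\<close>
  have "(\<lambda>j. (1 - s j) * Sf n x + n * excess_pressure 1 / c j) \<longlonglongrightarrow> (1 - 1) * Sf n x + 0"
    using s_lim c_top by (intro tendsto_intros tendsto_divide_0[of _ _ _ c] filterlim_at_top_imp_at_infinity) auto
  then have "\<forall>\<^sub>F j in sequentially. (1 - s j) * Sf n x + n * excess_pressure 1 / c j < e / 2"
    by (rule order_tendstoD) (use e in simp)
  moreover have "\<forall>\<^sub>F j in sequentially. 1 \<le> c j" using c_top by (simp add: filterlim_at_top)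
  ultimately show ?thesis
  proof eventually_elim
    case (elim j)
    let ?c = "c j" and ?s = "s j"
    have "?c * ((1 - ?s) * Sf n x + n * excess_pressure 1 / ?c) \<le> ?c * (e / 2)"
      using elim c_pos[of j] by (intro mult_left_mono) auto
    then have 1: "?c * ((1 - ?s) * Sf n x) + n * excess_pressure 1 \<le> ?c * (e / 2)"
      using c_pos[of j] by (simp add: distrib_left)
    have 2: "n * excess_pressure ?c \<le> n * excess_pressure 1" using elim by (intro mult_left_mono excess_pressure_antimono) auto
    have 3: "?c * (n * m - Sf n x) \<le> ?c * (J + e / 2)" using nx c_pos[of j] by (intro mult_left_mono) auto
    have "?c * ?s * Sf n x - n * P ?c = - (?c * (n * m - Sf n x)) - ?c * ((1 - ?s) * Sf n x) - n * excess_pressure ?c"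
      by (simp add: excess_pressure_def algebra_simps)
    then have "?c * (- J - e) \<le> ?c * ?s * Sf n x - n * P ?c"
      using 1 2 3 by (simp add: algebra_simps)
    then have "exp (?c * (- J - e)) \<le> exp (?c * ?s * Sf n x - n * P ?c)" by simp
    also have "\<dots> \<le> zeta_sum ?c ?s A" by (intro zeta_sum_lower c_pos s_pos s_less n x)
    finally show ?case .
  qed
qed

lemma zeta_sum_pos: "zeta_sum (c j) (s j) A > 0"
proof -
  obtain n x where "n \<ge> 1" "x \<in> fix_pts d n \<inter> A" using J_upper[of 1] by auto
  from zeta_sum_lower[OF c_pos s_pos s_less this, of j] show ?thesis
    by (meson exp_gt_zero less_le_trans)
qed

lemma zeta_sum_log_tendsto: "(\<lambda>j. ln (zeta_sum (c j) (s j) A) / c j) \<longlonglongrightarrow> - J"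
proof (rule tendstoI)
  fix e :: real assume e: "e > 0"
  show "\<forall>\<^sub>F j in sequentially. dist (ln (zeta_sum (c j) (s j) A) / c j) (- J) < e"
    using zeta_sum_eventually_le[OF half_gt_zero[OF e]] zeta_sum_eventually_ge[OF half_gt_zero[OF e]]
  proof eventually_elim
    case (elim j)
    let ?Z = "zeta_sum (c j) (s j) A"
    have "ln ?Z \<le> c j * (- J + e / 2)" "c j * (- J - e / 2) \<le> ln ?Z"
      using elim zeta_sum_pos[of j] by (auto intro: ln_le_of_le_exp simp: ln_ge_iff)
    then have "ln ?Z / c j \<le> - J + e / 2" "- J - e / 2 \<le> ln ?Z / c j"
      using c_pos[of j] by (auto simp: field_simps)
    then show ?case using e by (auto simp: dist_real_def abs_if)
  qed
qed

end

end

section \<open>The measures given by the zeta sums\<close>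

lemma expectation_bind_pmf:
  fixes g :: "'b \<Rightarrow> real"
  assumes "\<And>x. \<bar>g x\<bar> \<le> B"
  shows "measure_pmf.expectation (bind_pmf p k) g =
    measure_pmf.expectation p (\<lambda>x. measure_pmf.expectation (k x) g)"
  unfolding measure_pmf_bind
proof (rule integral_bind[where K = "count_space UNIV" and B = B and B' = 1])
  show "(\<lambda>x. measure_pmf (k x)) \<in> measure_pmf p \<rightarrow>\<^sub>M subprob_algebra (count_space UNIV)"
    by (auto simp: space_subprob_algebra measure_pmf.subprob_space_axioms)
qed (use assms in \<open>auto intro: measure_pmf.finite_measure_axioms\<close>)

lemma expectation_nat_pmf_sums:
  fixes F :: "nat \<Rightarrow> real"
  assumes "\<And>n. \<bar>F n\<bar> \<le> B"
  shows "(\<lambda>n. pmf p n * F n) sums measure_pmf.expectation p F"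
proof -
  have "integrable (measure_pmf p) F"
    by (rule measure_pmf.integrable_const_bound[of _ B]) (use assms in auto)
  then have "integrable (count_space UNIV) (\<lambda>n. pmf p n * F n)"
    by (simp add: measure_pmf_eq_density integrable_density)
  from sums_integral_count_space_nat[OF this] show ?thesis
    by (simp add: measure_pmf_eq_density integral_density)
qed

lemma bij_betw_shift_fix_pts:
  assumes "i \<le> n"
  shows "bij_betw (shift ^^ i) (fix_pts d n) (fix_pts d n)"
proof (rule bij_betw_byWitness[where f' = "shift ^^ (n - i)"])
  show "\<forall>x\<in>fix_pts d n. (shift ^^ (n - i)) ((shift ^^ i) x) = x"
    "\<forall>x\<in>fix_pts d n. (shift ^^ i) ((shift ^^ (n - i)) x) = x"
    using assms by (auto simp: fix_pts_iff shift_funpow)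
  show "(shift ^^ i) ` fix_pts d n \<subseteq> fix_pts d n" "(shift ^^ (n - i)) ` fix_pts d n \<subseteq> fix_pts d n"
    by (auto simp: fix_pts_iff shift_funpow shift_space_def add.left_commute[of i n] add.left_commute[of "n - i" n])
qed

text \<open>Each power of the shift permutes \<open>fix_pts d n\<close> and preserves
  \<open>W\<close>. Averaging an indicator along orbits therefore amounts to counting the weighted
  periodic points in the set.\<close>

lemma sum_fix_pts_birkhoff:
  fixes W g :: "(nat \<Rightarrow> nat) \<Rightarrow> real"
  assumes "\<And>x i. x \<in> fix_pts d n \<Longrightarrow> W ((shift ^^ i) x) = W x"
  shows "(\<Sum>x\<in>fix_pts d n. W x * birkhoff_sum shift n g x) = n * (\<Sum>x\<in>fix_pts d n. W x * g x)"
proof -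
  have "(\<Sum>x\<in>fix_pts d n. W x * birkhoff_sum shift n g x) = (\<Sum>i<n. \<Sum>x\<in>fix_pts d n. W x * g ((shift ^^ i) x))"
    unfolding birkhoff_sum_def sum_distrib_left by (rule sum.swap)
  also have "\<dots> = (\<Sum>i<n. \<Sum>x\<in>fix_pts d n. W x * g x)"
  proof (rule sum.cong)
    fix i assume "i \<in> {..<n}"
    then have bij: "bij_betw (shift ^^ i) (fix_pts d n) (fix_pts d n)"
      by (intro bij_betw_shift_fix_pts) auto
    have "(\<Sum>x\<in>fix_pts d n. W x * g ((shift ^^ i) x)) = (\<Sum>x\<in>fix_pts d n. W ((shift ^^ i) x) * g ((shift ^^ i) x))"
      using assms by simp
    also have "\<dots> = (\<Sum>x\<in>fix_pts d n. W x * g x)" by (rule sum.reindex_bij_betw[OF bij])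
    finally show "(\<Sum>x\<in>fix_pts d n. W x * g ((shift ^^ i) x)) = (\<Sum>x\<in>fix_pts d n. W x * g x)" .
  qed simp
  finally show ?thesis by simp
qed

lemma bounded_continuous_shift_space:
  fixes g :: "(nat \<Rightarrow> nat) \<Rightarrow> real"
  assumes "continuous_on (shift_space d) g"
  shows "\<exists>B. \<forall>x\<in>shift_space d. \<bar>g x\<bar> \<le> B"
  using compact_imp_bounded[OF compact_continuous_image[OF assms compact_shift_space]]
  by (auto simp: bounded_iff)

context positive_lipschitz_potential
begin

context
  fixes c s :: real
  assumes cs: "c > 0" "0 < s" "s < 1"
begin

abbreviation "weight \<equiv> zeta_weight d \<theta> f c s"

lemma weight_eq: "weight n x = exp (c * s * Sf n x - n * P c)"
  using cs by (simp add: zeta_weight_def pressure_eq_P)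

lemma zeta_term_UNIV: "zeta_term c s UNIV n = (\<Sum>x\<in>fix_pts d n. weight n x)"
  by (simp add: zeta_term_def weight_eq)

lemma zeta_term_pos: "n \<ge> 1 \<Longrightarrow> zeta_term c s UNIV n > 0"
  unfolding zeta_term_UNIV weight_eq using finite_fix_pts const_fix_pts[OF d_ge]
  by (intro sum_pos) auto

lemma zeta_total_pos: "zeta_sum c s UNIV > 0"
  by (rule less_le_trans[OF exp_gt_zero zeta_sum_lower[OF cs, of 1 "\<lambda>_. 1" UNIV]])
     (use const_fix_pts[OF d_ge] in auto)

text \<open>The value \<open>n\<close> stands for the period \<open>Suc n\<close>, since the series
  starts at period 1.\<close>

definition period_pmf :: "nat pmf" where
  "period_pmf = embed_pmf (\<lambda>n. zeta_term c s UNIV (Suc n) / zeta_sum c s UNIV)"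

definition fix_pmf :: "nat \<Rightarrow> (nat \<Rightarrow> nat) pmf" where
  "fix_pmf n = embed_pmf (\<lambda>x. if x \<in> fix_pts d n then weight n x / zeta_term c s UNIV n else 0)"

text \<open>The measure as a mixture: a random period, then a weighted random point of that period,
  then a uniformly random iterate of it. This construction supplies existence without a
  representation theorem.\<close>

definition zeta_pmf :: "(nat \<Rightarrow> nat) pmf" where
  "zeta_pmf = bind_pmf period_pmf (\<lambda>n. bind_pmf (fix_pmf (Suc n)) (orbit_pmf (Suc n)))"

lemma pmf_period_pmf: "pmf period_pmf n = zeta_term c s UNIV (Suc n) / zeta_sum c s UNIV"
  unfolding period_pmf_def
proof (rule pmf_embed_pmf)
  show "0 \<le> zeta_term c s UNIV (Suc n) / zeta_sum c s UNIV" for n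
    using zeta_total_pos by (simp add: zeta_term_nonneg)
  have "(\<lambda>n. zeta_term c s UNIV (Suc n) / zeta_sum c s UNIV) sums (zeta_sum c s UNIV / zeta_sum c s UNIV)"
    unfolding zeta_sum_def by (intro sums_divide summable_sums zeta_term_summable cs)
  then show "(\<integral>\<^sup>+n. ennreal (zeta_term c s UNIV (Suc n) / zeta_sum c s UNIV) \<partial>count_space UNIV) = 1"
    unfolding nn_integral_count_space_nat using zeta_total_pos
    by (subst suminf_ennreal_eq[where x = 1]) (auto simp: zeta_term_nonneg)
qed

lemma pmf_fix_pmf:
  assumes "n \<ge> 1"
  shows "pmf (fix_pmf n) x = (if x \<in> fix_pts d n then weight n x / zeta_term c s UNIV n else 0)"
  unfolding fix_pmf_def
proof (rule pmf_embed_pmf)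
  let ?w = "\<lambda>x. if x \<in> fix_pts d n then weight n x / zeta_term c s UNIV n else 0"
  show nonneg: "0 \<le> ?w x" for x by (simp add: zeta_term_nonneg weight_eq)
  have "(\<integral>\<^sup>+x. ennreal (?w x) \<partial>count_space UNIV) = (\<Sum>x\<in>fix_pts d n. ennreal (?w x))"
    using finite_fix_pts[OF assms] by (intro nn_integral_count_space') (auto split: if_splits)
  also have "\<dots> = ennreal (\<Sum>x\<in>fix_pts d n. ?w x)" using nonneg by (intro sum_ennreal)
  also have "(\<Sum>x\<in>fix_pts d n. ?w x) = 1"
    using zeta_term_pos[OF assms] by (simp add: sum_divide_distrib[symmetric] zeta_term_UNIV)
  finally show "(\<integral>\<^sup>+x. ennreal (?w x) \<partial>count_space UNIV) = 1" by simp
qed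

lemma set_fix_pmf: "n \<ge> 1 \<Longrightarrow> set_pmf (fix_pmf n) \<subseteq> fix_pts d n"
  by (auto simp: set_pmf_eq pmf_fix_pmf split: if_splits)

lemma set_zeta_pmf: "set_pmf zeta_pmf \<subseteq> X"
  unfolding zeta_pmf_def using set_fix_pmf set_orbit_pmf[of "Suc _"] fix_pts_space by fastforce

lemma map_shift_zeta_pmf: "map_pmf shift zeta_pmf = zeta_pmf"
  unfolding zeta_pmf_def map_bind_pmf using set_fix_pmf
  by (intro bind_pmf_cong refl map_shift_orbit_pmf) auto

text \<open>Conditioning on the period and then on the periodic point leaves orbit averages; the
  normalizations \<open>zeta_term\<close> cancel between the two stages.\<close>

lemma expectation_zeta_pmf:
  assumes B: "\<And>x. \<bar>g x\<bar> \<le> B"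
  shows "measure_pmf.expectation zeta_pmf g = zeta_mean d \<theta> f c s g"
proof -
  let ?Z = "zeta_sum c s UNIV"
  define F where "F n = measure_pmf.expectation (bind_pmf (fix_pmf (Suc n)) (orbit_pmf (Suc n))) g" for n
  have "\<bar>F n\<bar> \<le> B" for n
  proof -
    have "\<bar>F n\<bar> \<le> measure_pmf.expectation (bind_pmf (fix_pmf (Suc n)) (orbit_pmf (Suc n))) (\<lambda>x. \<bar>g x\<bar>)"
      unfolding F_def using integral_norm_bound[of _ g] by simp
    also have "\<dots> \<le> B"
      by (intro measure_pmf.integral_le_const measure_pmf.integrable_const_bound[of _ B])
        (auto simp: B)
    finally show ?thesis .
  qed
  from expectation_nat_pmf_sums[OF this, of period_pmf]
  have "(\<lambda>n. pmf period_pmf n * F n) sums measure_pmf.expectation zeta_pmf g"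
    unfolding zeta_pmf_def by (subst expectation_bind_pmf[OF B]) (simp add: F_def)
  then have "(\<lambda>n. pmf period_pmf n * F n * ?Z) sums (measure_pmf.expectation zeta_pmf g * ?Z)"
    by (rule sums_mult2)
  moreover have "pmf period_pmf n * F n * ?Z =
      (\<Sum>x\<in>fix_pts d (Suc n). weight (Suc n) x * (birkhoff_sum shift (Suc n) g x / real (Suc n)))" for n
  proof -
    have "F n = (\<Sum>x\<in>fix_pts d (Suc n). birkhoff_sum shift (Suc n) g x / real (Suc n) * pmf (fix_pmf (Suc n)) x)"
      unfolding F_def expectation_bind_pmf[OF B] using set_fix_pmf[of "Suc n"] finite_fix_pts[of "Suc n" d]
      by (simp only: expectation_orbit_pmf le_add1 Suc_eq_plus1_left) (intro integral_measure_pmf_real, auto)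
    also have "\<dots> = (\<Sum>x\<in>fix_pts d (Suc n). weight (Suc n) x * (birkhoff_sum shift (Suc n) g x / real (Suc n))) /
        zeta_term c s UNIV (Suc n)"
      unfolding sum_divide_distrib by (intro sum.cong refl) (simp add: pmf_fix_pmf)
    finally show ?thesis
      using zeta_term_pos[of "Suc n"] zeta_total_pos by (simp add: pmf_period_pmf)
  qed
  ultimately have "(\<Sum>n. \<Sum>x\<in>fix_pts d (Suc n). weight (Suc n) x * (birkhoff_sum shift (Suc n) g x / real (Suc n)))
      = measure_pmf.expectation zeta_pmf g * ?Z"
    by (simp add: sums_iff)
  then show ?thesis
    using zeta_total_pos unfolding zeta_mean_def by (simp add: zeta_sum_def zeta_term_UNIV)
qed

lemma zeta_mean_cong:
  assumes "\<And>x. x \<in> X \<Longrightarrow> g x = g' x"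
  shows "zeta_mean d \<theta> f c s g = zeta_mean d \<theta> f c s g'"
proof -
  have "birkhoff_sum shift n g x = birkhoff_sum shift n g' x" if "x \<in> fix_pts d n" for n x
    using assms shift_funpow_space[OF fix_pts_space[OF that]] by (simp add: birkhoff_sum_def)
  then show ?thesis by (simp add: zeta_mean_def)
qed

text \<open>The embedded mixture has the prescribed integrals, and
  \<open>measure_eq_of_integrals\<close> makes it the only such measure, so the definite description
  is meaningful.\<close>

lemma zeta_measure_eq: "zeta_measure d \<theta> f c s = embed_measure_pmf zeta_pmf"
proof -
  let ?M = "embed_measure_pmf zeta_pmf"
  have inv: "?M \<in> invariant_probs d"
    by (intro embed_measure_pmf_invariant set_zeta_pmf map_shift_zeta_pmf)
  have int: "integral\<^sup>L ?M g = zeta_mean d \<theta> f c s g" if g: "continuous_on X g" for g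
  proof -
    obtain B where B: "\<forall>x\<in>X. \<bar>g x\<bar> \<le> B" using bounded_continuous_shift_space[OF g] by blast
    then have B0: "0 \<le> B" using const_X by force
    \<comment> \<open>\<open>expectation_zeta_pmf\<close> asks for a global bound while
      \<open>g\<close> is controlled only on \<open>X\<close>; the cutoff changes neither
      side.\<close>
    let ?g = "\<lambda>x. if x \<in> X then g x else 0"
    have "integral\<^sup>L ?M g = measure_pmf.expectation zeta_pmf g"
      by (intro integral_embed_measure_pmf set_zeta_pmf borel_measurable_continuous_on_restrict g)
    also have "\<dots> = measure_pmf.expectation zeta_pmf ?g"
      by (intro integral_cong_AE) (use set_zeta_pmf in \<open>auto simp: AE_measure_pmf_iff\<close>)
    also have "\<dots> = zeta_mean d \<theta> f c s ?g"
      using B B0 by (intro expectation_zeta_pmf) auto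
    also have "\<dots> = zeta_mean d \<theta> f c s g" by (rule zeta_mean_cong) simp
    finally show ?thesis .
  qed
  show ?thesis
    unfolding zeta_measure_def
  proof (rule the_equality)
    fix M assume M: "M \<in> invariant_probs d \<and>
      (\<forall>g. continuous_on X g \<longrightarrow> integral\<^sup>L M g = zeta_mean d \<theta> f c s g)"
    then show "M = ?M"
      using invariant_probsD(1,2) inv int by (intro measure_eq_of_integrals[of M ?M d]) auto
  qed (use inv int in auto)
qed

lemma measure_zeta_measure_cylinder:
  "measure (zeta_measure d \<theta> f c s) (cylinder d w) = zeta_sum c s (cylinder d w) / zeta_sum c s UNIV"
proof -
  let ?k = "cylinder d w" and ?M = "embed_measure_pmf zeta_pmf"
  let ?g = "indicator ?k :: _ \<Rightarrow> real"
  have g: "?g \<in> borel_measurable (shift_borel d)"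
    by (intro borel_measurable_continuous_on_restrict continuous_indicator_cylinder)
  have inv: "?M \<in> invariant_probs d"
    by (intro embed_measure_pmf_invariant set_zeta_pmf map_shift_zeta_pmf)
  interpret M: prob_space ?M by (rule invariant_probsD(1)[OF inv])
  have "measure ?M ?k = integral\<^sup>L ?M ?g"
    using cylinder_sets[of d w] invariant_probsD(2)[OF inv] by (simp add: M.emeasure_eq_measure)
  also have "\<dots> = measure_pmf.expectation zeta_pmf ?g"
    by (rule integral_embed_measure_pmf[OF set_zeta_pmf g])
  also have "\<dots> = zeta_mean d \<theta> f c s ?g"
    by (rule expectation_zeta_pmf[of _ 1]) (simp add: indicator_def)
  also have "\<dots> = zeta_sum c s ?k / zeta_sum c s UNIV"
  proof -
    have "(\<Sum>x\<in>fix_pts d (Suc n). weight (Suc n) x * (birkhoff_sum shift (Suc n) ?g x / real (Suc n)))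
        = zeta_term c s ?k (Suc n)" for n
    proof -
      have "(\<Sum>x\<in>fix_pts d (Suc n). weight (Suc n) x * (birkhoff_sum shift (Suc n) ?g x / real (Suc n)))
          = (\<Sum>x\<in>fix_pts d (Suc n). weight (Suc n) x * birkhoff_sum shift (Suc n) ?g x) / real (Suc n)"
        by (simp add: sum_divide_distrib del: of_nat_Suc)
      also have "\<dots> = (\<Sum>x\<in>fix_pts d (Suc n). weight (Suc n) x * ?g x)"
        by (subst sum_fix_pts_birkhoff) (simp_all add: weight_eq birkhoff_sum_shift_fix)
      also have "\<dots> = zeta_term c s ?k (Suc n)"
        unfolding zeta_term_def sum.inter_restrict[OF finite_fix_pts[of "Suc n" d, simplified]]
        by (intro sum.cong) (simp_all add: weight_eq indicator_def)
      finally show ?thesis .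
    qed
    then show ?thesis unfolding zeta_mean_def by (simp add: zeta_sum_def zeta_term_UNIV)
  qed
  finally show ?thesis by (simp add: zeta_measure_eq)
qed

end

section \<open>The deviation function and the large deviation limit\<close>

definition rate_near :: "(nat \<Rightarrow> nat) \<Rightarrow> real \<Rightarrow> ereal" where
  "rate_near x \<epsilon> = (INF y\<in>{y \<in> per_pts d. shift_dist \<theta> y x \<le> \<epsilon>}. ereal (per_rate d f y))"

lemma rate_near_antimono: "\<epsilon> \<le> \<epsilon>' \<Longrightarrow> rate_near x \<epsilon>' \<le> rate_near x \<epsilon>"
  unfolding rate_near_def by (rule INF_superset_mono) auto

text \<open>Infima over shrinking balls increase, so the limit exists and is a supremum.\<close>

lemma deviation_fun_eq_SUP: "deviation_fun d \<theta> f x = (SUP \<epsilon>\<in>{0<..}. rate_near x \<epsilon>)"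
proof -
  have "((\<lambda>\<epsilon>. rate_near x \<epsilon>) \<longlongrightarrow> (SUP \<epsilon>\<in>{0<..}. rate_near x \<epsilon>)) (at_right 0)"
  proof (rule order_tendstoI)
    fix a assume "a < (SUP \<epsilon>\<in>{0<..}. rate_near x \<epsilon>)"
    then obtain \<epsilon>0 where \<epsilon>0: "\<epsilon>0 > 0" "a < rate_near x \<epsilon>0" by (auto simp: less_SUP_iff)
    show "\<forall>\<^sub>F \<epsilon> in at_right 0. a < rate_near x \<epsilon>"
      using eventually_at_right_real[OF \<epsilon>0(1)]
    proof eventually_elim
      case (elim \<epsilon>)
      then show ?case using rate_near_antimono[of \<epsilon> \<epsilon>0 x] \<epsilon>0(2) by (auto intro: less_le_trans)
    qed
  next
    fix a assume a: "(SUP \<epsilon>\<in>{0<..}. rate_near x \<epsilon>) < a"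
    have "\<forall>\<^sub>F \<epsilon> in at_right (0::real). \<epsilon> > 0" by (rule eventually_at_right_less)
    then show "\<forall>\<^sub>F \<epsilon> in at_right 0. rate_near x \<epsilon> < a"
    proof eventually_elim
      case (elim \<epsilon>)
      then have "rate_near x \<epsilon> \<le> (SUP \<epsilon>\<in>{0<..}. rate_near x \<epsilon>)" by (intro SUP_upper) auto
      then show ?case using a by (rule le_less_trans)
    qed
  qed
  then show ?thesis unfolding deviation_fun_def rate_near_def by (intro tendsto_Lim) auto
qed

lemma rate_near_le_deviation_fun: "\<epsilon> > 0 \<Longrightarrow> rate_near x \<epsilon> \<le> deviation_fun d \<theta> f x"
  unfolding deviation_fun_eq_SUP by (intro SUP_upper) auto

lemma deviation_fun_nonneg: "0 \<le> deviation_fun d \<theta> f x"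
proof -
  have "0 \<le> rate_near x 1" unfolding rate_near_def by (intro INF_greatest) (auto simp: per_rate_nonneg)
  also have "\<dots> \<le> deviation_fun d \<theta> f x" by (rule rate_near_le_deviation_fun) simp
  finally show ?thesis .
qed

text \<open>By the ultrametric inequality the \<open>\<epsilon>\<close>-ball around a point near
  \<open>x\<close> is contained in that around \<open>x\<close>, so a lower bound for
  \<open>rate_near x \<epsilon>\<close> persists nearby.\<close>

lemma lower_semicont_deviation_fun: "lower_semicont_on X (deviation_fun d \<theta> f)"
  unfolding lower_semicont_on_def le_Liminf_iff
proof (intro ballI allI impI)
  fix x a assume "x \<in> X" and "a < deviation_fun d \<theta> f x"
  then obtain \<epsilon> where \<epsilon>: "\<epsilon> > 0" "a < rate_near x \<epsilon>" by (auto simp: deviation_fun_eq_SUP less_SUP_iff)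
  have "(\<lambda>n. \<theta> ^ Suc n) \<longlonglongrightarrow> 0"
    using theta_pos theta_less by (intro LIMSEQ_Suc LIMSEQ_realpow_zero) auto
  then have "\<forall>\<^sub>F n in sequentially. \<theta> ^ Suc n < \<epsilon>" using \<epsilon>(1) by (simp add: order_tendsto_iff)
  then obtain n where n: "\<theta> ^ Suc n < \<epsilon>" by (auto simp: eventually_sequentially)
  have "a < deviation_fun d \<theta> f y" if "\<forall>i<n. y i = x i" for y
  proof -
    have "shift_dist \<theta> y x \<le> \<epsilon>"
      using shift_dist_le_iff[OF theta_pos theta_less, of y x n] that n by simp
    then have "rate_near x \<epsilon> \<le> rate_near y \<epsilon>"
      unfolding rate_near_def using shift_dist_ultra[OF theta_pos theta_less]
      by (intro INF_superset_mono) auto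
    then show ?thesis using \<epsilon> rate_near_le_deviation_fun[of \<epsilon> y] by (meson less_le_trans)
  qed
  then show "\<forall>\<^sub>F y in at x within X. a < deviation_fun d \<theta> f y"
    unfolding eventually_at_topological using open_prefix[of n x]
    by (intro exI[of _ "{y. \<forall>i<n. y i = x i}"]) auto
qed

text \<open>A periodic point lies in all balls around itself, which gives one inequality. For the
  other, a ball of radius \<open>\<theta> ^ Suc (length w)\<close> around a point of the cylinder
  contains only periodic points of the cylinder.\<close>

lemma INF_deviation_fun_cylinder:
  "(INF x\<in>cylinder d w. deviation_fun d \<theta> f x) = (INF y\<in>per_pts d \<inter> cylinder d w. ereal (per_rate d f y))"
proof (rule antisym)
  show "(INF x\<in>cylinder d w. deviation_fun d \<theta> f x) \<le> (INF y\<in>per_pts d \<inter> cylinder d w. ereal (per_rate d f y))"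
  proof (rule INF_mono)
    fix y assume y: "y \<in> per_pts d \<inter> cylinder d w"
    have "deviation_fun d \<theta> f y \<le> ereal (per_rate d f y)"
      unfolding deviation_fun_eq_SUP rate_near_def using y
      by (intro SUP_least INF_lower) (auto simp: shift_dist_def)
    then show "\<exists>x\<in>cylinder d w. deviation_fun d \<theta> f x \<le> ereal (per_rate d f y)" using y by blast
  qed
  show "(INF y\<in>per_pts d \<inter> cylinder d w. ereal (per_rate d f y)) \<le> (INF x\<in>cylinder d w. deviation_fun d \<theta> f x)"
  proof (rule INF_greatest)
    fix x assume x: "x \<in> cylinder d w"
    have "(INF y\<in>per_pts d \<inter> cylinder d w. ereal (per_rate d f y)) \<le> rate_near x (\<theta> ^ Suc (length w))"
      unfolding rate_near_def shift_dist_le_iff[OF theta_pos theta_less]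
      using x fix_pts_space by (intro INF_superset_mono) (auto simp: cylinder_def per_pts_def)
    also have "\<dots> \<le> deviation_fun d \<theta> f x"
      using theta_pos by (intro rate_near_le_deviation_fun) simp
    finally show "(INF y\<in>per_pts d \<inter> cylinder d w. ereal (per_rate d f y)) \<le> deviation_fun d \<theta> f x" .
  qed
qed

lemma exists_periodic_in_cylinder:
  assumes "set w \<subseteq> {1..d}"
  shows "\<exists>n\<ge>1. \<exists>y\<in>fix_pts d n. y \<in> cylinder d w"
proof -
  let ?x = "\<lambda>i. if i < length w then w ! i else 1"
  have "?x \<in> X" using assms d_ge by (force simp: shift_space_def subset_iff)
  \<comment> \<open>The period \<open>Suc (length w)\<close> is positive even for the empty
    word.\<close>
  then have per: "repeat_prefix (Suc (length w)) ?x \<in> fix_pts d (Suc (length w))"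
    by (rule repeat_prefix_fix_pts)
  then have "repeat_prefix (Suc (length w)) ?x \<in> cylinder d w"
    using fix_pts_space by (auto simp: cylinder_def repeat_prefix_def)
  then show ?thesis using per by (intro exI[of _ "Suc (length w)"]) auto
qed

text \<open>The measure of the cylinder is a quotient of two zeta sums. The numerator has rate
  \<open>- J\<close>; the denominator has rate 0 by \<open>exists_fix_small_defect\<close>.\<close>

lemma large_deviation_cylinder:
  fixes c s :: "nat \<Rightarrow> real"
  assumes c: "\<And>j. c j > 0" and s: "\<And>j. 0 < s j" "\<And>j. s j < 1"
    and lim: "filterlim c at_top sequentially" "s \<longlonglongrightarrow> 1"
    and ell: "ell > 0" "\<forall>\<^sub>F j in sequentially. ell \<le> c j * (1 - s j)"
    and w: "set w \<subseteq> {1..d}"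
  shows "(\<lambda>j. ereal (1 / c j * ln (measure (zeta_measure d \<theta> f (c j) (s j)) (cylinder d w))))
    \<longlonglongrightarrow> - (INF x\<in>cylinder d w. deviation_fun d \<theta> f x)"
proof -
  let ?k = "cylinder d w"
  let ?I = "INF y\<in>per_pts d \<inter> ?k. ereal (per_rate d f y)"
  obtain n0 y0 where y0: "n0 \<ge> 1" "y0 \<in> fix_pts d n0" "y0 \<in> ?k"
    using exists_periodic_in_cylinder[OF w] by blast
  have "?I \<le> ereal (per_rate d f y0)" using y0 by (intro INF_lower) (auto simp: per_pts_def)
  moreover have I0: "0 \<le> ?I" by (intro INF_greatest) (auto simp: per_rate_nonneg)
  \<comment> \<open>A periodic point inside the cylinder makes the infimum finite, hence a real
    number.\<close>
  ultimately obtain J where J: "?I = ereal J" by (cases ?I) auto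
  have J0: "J \<ge> 0" using I0 J by simp
  have J_lower: "J \<le> n * m - Sf n x" if "n \<ge> 1" "x \<in> fix_pts d n \<inter> ?k" for n x
  proof -
    have "?I \<le> ereal (per_rate d f x)" using that by (intro INF_lower) (auto simp: per_pts_def)
    then show ?thesis using J per_rate_le_defect[of n x] that by simp
  qed
  have J_upper: "\<exists>n\<ge>1. \<exists>x\<in>fix_pts d n \<inter> ?k. n * m - Sf n x \<le> J + e" if e: "e > 0" for e
  proof -
    have "?I < ereal (J + e)" using J e by simp
    then obtain y where y: "y \<in> per_pts d" "y \<in> ?k" "per_rate d f y < J + e"
      unfolding INF_less_iff by auto
    from y(1) obtain n where "n \<ge> 1" "y \<in> fix_pts d n" by (auto simp: per_pts_def)
    \<comment> \<open>At the minimal period the defect equals the rate.\<close>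
    from min_period_fix_pts(1,2)[OF this(2,1)] show ?thesis
      using y by (intro exI[of _ "min_period y"]) (auto simp: per_rate_def intro!: bexI[of _ y])
  qed
  have total_lower: "0 \<le> n * m - Sf n x" if "n \<ge> 1" "x \<in> fix_pts d n \<inter> UNIV" for n x
    using Sf_fix_le[of n x] that by simp
  have total_upper: "\<exists>n\<ge>1. \<exists>x\<in>fix_pts d n \<inter> UNIV. n * m - Sf n x \<le> 0 + e" if "e > 0" for e
    using exists_fix_small_defect[OF that] by simp
  note cyl = zeta_sum_log_tendsto[OF c s lim ell J_lower J_upper J0]
  note tot = zeta_sum_log_tendsto[OF c s lim ell total_lower total_upper order_refl]
  have eq: "1 / c j * ln (measure (zeta_measure d \<theta> f (c j) (s j)) ?k) =
      ln (zeta_sum (c j) (s j) ?k) / c j - ln (zeta_sum (c j) (s j) UNIV) / c j" for j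
    using zeta_sum_pos[OF c s lim ell J_lower J_upper J0, of j] zeta_total_pos[OF c[of j] s(1)[of j] s(2)[of j]]
    by (simp add: measure_zeta_measure_cylinder[OF c[of j] s(1)[of j] s(2)[of j]] ln_div diff_divide_distrib)
  have "(\<lambda>j. 1 / c j * ln (measure (zeta_measure d \<theta> f (c j) (s j)) ?k)) \<longlonglongrightarrow> - J"
    unfolding eq using tendsto_diff[OF cyl tot] by simp
  then show ?thesis by (simp add: INF_deviation_fun_cylinder J)
qed

end

theorem corollary5:
  fixes d :: nat and \<theta> L :: real and f :: "(nat \<Rightarrow> nat) \<Rightarrow> real"
  assumes "d \<ge> 1"
    and "0 < \<theta>" and "\<theta> < 1"
    and "shift_lipschitz d \<theta> f"
    and "\<And>x. x \<in> shift_space d \<Longrightarrow> f x > 0"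
    and "L > 0"
  shows "lower_semicont_on (shift_space d) (deviation_fun d \<theta> f) \<and>
    (\<forall>x\<in>shift_space d. 0 \<le> deviation_fun d \<theta> f x) \<and>
    (\<forall>(c :: nat \<Rightarrow> real) (s :: nat \<Rightarrow> real) w.
      (\<forall>j. c j > 0) \<longrightarrow> (\<forall>j. 0 < s j \<and> s j < 1) \<longrightarrow>
      filterlim c at_top sequentially \<longrightarrow> s \<longlonglongrightarrow> 1 \<longrightarrow>
      ((\<lambda>j. c j * (1 - s j)) \<longlonglongrightarrow> L \<or> liminf (\<lambda>j. ereal (c j * (1 - s j))) = ereal L) \<longrightarrow>
      set w \<subseteq> {1..d} \<longrightarrow>
      (\<lambda>j. ereal (1 / c j * ln (measure (zeta_measure d \<theta> f (c j) (s j)) (cylinder d w))))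
        \<longlonglongrightarrow> - (INF x\<in>cylinder d w. deviation_fun d \<theta> f x))"
proof -
  obtain C where C: "\<And>x y. x \<in> shift_space d \<Longrightarrow> y \<in> shift_space d \<Longrightarrow> \<bar>f x - f y\<bar> \<le> C * shift_dist \<theta> x y"
    using assms(4) by (auto simp: shift_lipschitz_def)
  \<comment> \<open>The given Lipschitz constant may be negative, for instance on a one-point space;
    \<open>max C 0\<close> repairs this.\<close>
  interpret positive_lipschitz_potential d \<theta> "max C 0" f
  proof
    fix x y assume "x \<in> shift_space d" "y \<in> shift_space d"
    then show "\<bar>f x - f y\<bar> \<le> max C 0 * shift_dist \<theta> x y"
      using C shift_dist_nonneg[OF assms(2)] by (meson max.cobounded1 mult_right_mono order_trans)
  qed (use assms in auto)
  show ?thesis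
  proof (intro conjI allI impI ballI lower_semicont_deviation_fun deviation_fun_nonneg)
    fix c s :: "nat \<Rightarrow> real" and w
    assume c: "\<forall>j. c j > 0" and s: "\<forall>j. 0 < s j \<and> s j < 1"
      and lim: "filterlim c at_top sequentially" "s \<longlonglongrightarrow> 1"
      and L: "(\<lambda>j. c j * (1 - s j)) \<longlonglongrightarrow> L \<or> liminf (\<lambda>j. ereal (c j * (1 - s j))) = ereal L"
      and w: "set w \<subseteq> {1..d}"
    \<comment> \<open>Both hypotheses on \<open>c j * (1 - s j)\<close> enter only through this
      common lower bound.\<close>
    have "\<forall>\<^sub>F j in sequentially. ereal (L / 2) < ereal (c j * (1 - s j))"
      using L
    proof
      assume "(\<lambda>j. c j * (1 - s j)) \<longlonglongrightarrow> L"
      then show ?thesis using order_tendstoD(1)[of _ L _ "L / 2"] assms(6) by simp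
    next
      assume "liminf (\<lambda>j. ereal (c j * (1 - s j))) = ereal L"
      then show ?thesis using assms(6) by (intro less_LiminfD) simp
    qed
    then have "\<forall>\<^sub>F j in sequentially. L / 2 \<le> c j * (1 - s j)" by (rule eventually_mono) simp
    then show "(\<lambda>j. ereal (1 / c j * ln (measure (zeta_measure d \<theta> f (c j) (s j)) (cylinder d w))))
        \<longlonglongrightarrow> - (INF x\<in>cylinder d w. deviation_fun d \<theta> f x)"
      using c s lim w assms(6) by (intro large_deviation_cylinder[where ell = "L / 2"]) auto
  qed
qed

end
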